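(* Let $f$ be a weak solution of the Smoluchowski system. (i) Let $T\in(0,\infty)$ and assume that $$\int_0^T\!\int Y_1\,dx\,dt<\infty\quad\text{and}\quad\int_0^T\!\int\hat Y_1\,dx\,dt<\infty.$$ Then $f$ conserves mass on the time interval $[0,T]$. (ii) Assume instead that $X_1(\cdot,0)\in L^\infty(\mathbb{R}^d)$, $X_2(\cdot,0)\in L^1(\mathbb{R}^d)$, that the function $d(\cdot)$ is uniformly positive (bounded below by a positive constant) and non-increasing, and that there exists a constant $C_0$ with $\alpha(n,m)\le C_0(n+m)$ for all $n,m$. Then $f$ conserves mass on the time interval $[0,\infty)$.
   Context: The integer $d\ge 1$ (written without argument) is the spatial dimension; $\mathbb{N}=\{1,2,\dots\}$; spatial integrals are over $\mathbb{R}^d$. The parameters are the diffusion rates $d(\cdot):\mathbb{N}\to[0,\infty)$ and the coagulation propensities $\alpha:\mathbb{N}^2\to[0,\infty)$, with $\alpha(n,m)=\alpha(m,n)$. The Smoluchowski system for $f=(f_n)_{n\in\mathbb{N}}$, $f_n:\mathbb{R}^d\times[0,\infty)\to[0,\infty)$, is $\partial_t f_n=d(n)\Delta f_n+Q_n(f)$, where $Q_n=Q_n^+-Q_n^-$, $Q_n^+(f)=\sum_{m=1}^{n-1}\alpha(m,n-m)f_mf_{n-m}$, $Q_n^-(f)=2f_n\sum_{m=1}^\infty\alpha(n,m)f_m$. A weak solution with initial data $f^0=(f^0_n)$ means: $Q_n^\pm(f)\in L^1(\mathbb{R}^d\times[0,T])$ for every $T\in[0,\infty)$ and $n\in\mathbb{N}$,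 and $f_n(\cdot,t)=S_t^{d(n)}f_n^0+\int_0^tS_{t-s}^{d(n)}Q_n(f)(\cdot,s)\,ds$, where $S_t^D$ is the semigroup of the equation $u_t=D\Delta u$. Moments: $X_a(x,t)=\sum_n n^af_n(x,t)$ (so $X_a(x,0)=\sum_n n^af_n^0(x)$), $$Y_a(x,t)=\sum_{n,m}nm(n^a+m^a)(d(n)+d(m))f_n(x,t)f_m(x,t),$$ $$\hat Y_a(x,t)=\sum_{n,m}(n^am+m^an)\,\alpha(n,m)f_n(x,t)f_m(x,t).$$ Mass conservation: $f$ conserves mass on a time interval ($[0,T]$ or $[0,\infty)$) if $I(t)=I(0)$ for every $t$ in that interval, where $I(t)=\sum_{m\in\mathbb{N}}m\int_{\mathbb{R}^d}f_m(x,t)\,dx$. *)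

theory Defs
  imports "HOL-Analysis.Analysis"
begin

text \<open>
  Space is \<open>real ^ 'd\<close>, so the dimension is \<open>CARD('d) \<ge> 1\<close>.  Cluster sizes are positive naturals:
  families are functions on \<open>nat\<close> of which only the indices \<open>n \<ge> 1\<close> matter, and a solution
  \<open>f n x t\<close> is only looked at for \<open>t \<ge> 0\<close>.  Quantities that may be infinite (infinite sums over
  cluster sizes, integrals of nonnegative functions) take values in \<open>ennreal\<close>.
\<close>

definition heat_kernel :: "real \<Rightarrow> (real, 'd::finite) vec \<Rightarrow> real" where
  "heat_kernel s z = (4 * pi * s) powr (- real CARD('d) / 2) * exp (- (norm z)\<^sup>2 / (4 * s))"

text \<open>The semigroup of \<open>u\<^sub>t = D \<Delta> u\<close>; it is the identity when \<open>t = 0\<close> or \<open>D = 0\<close>.\<close>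

definition heat_semigroup ::
    "real \<Rightarrow> real \<Rightarrow> ((real, 'd::finite) vec \<Rightarrow> real) \<Rightarrow> (real, 'd) vec \<Rightarrow> real" where
  "heat_semigroup D t u x =
     (if D * t = 0 then u x else LINT y|lborel. heat_kernel (D * t) (x - y) * u y)"

definition gain :: "(nat \<Rightarrow> nat \<Rightarrow> real) \<Rightarrow> (nat \<Rightarrow> (real, 'd::finite) vec \<Rightarrow> real \<Rightarrow> real)
    \<Rightarrow> nat \<Rightarrow> (real, 'd) vec \<Rightarrow> real \<Rightarrow> ennreal" where
  "gain \<alpha> f n x t = ennreal (\<Sum>m=1..<n. \<alpha> m (n - m) * f m x t * f (n - m) x t)"

definition loss :: "(nat \<Rightarrow> nat \<Rightarrow> real) \<Rightarrow> (nat \<Rightarrow> (real, 'd::finite) vec \<Rightarrow> real \<Rightarrow> real)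
    \<Rightarrow> nat \<Rightarrow> (real, 'd) vec \<Rightarrow> real \<Rightarrow> ennreal" where
  "loss \<alpha> f n x t = 2 * ennreal (f n x t) * (\<Sum>\<^sub>\<infinity>m\<in>{1..}. ennreal (\<alpha> n m * f m x t))"

text \<open>Only meaningful where the loss term is finite, which for weak solutions is almost everywhere.\<close>

definition coag :: "(nat \<Rightarrow> nat \<Rightarrow> real) \<Rightarrow> (nat \<Rightarrow> (real, 'd::finite) vec \<Rightarrow> real \<Rightarrow> real)
    \<Rightarrow> nat \<Rightarrow> (real, 'd) vec \<Rightarrow> real \<Rightarrow> real" where
  "coag \<alpha> f n x t = enn2real (gain \<alpha> f n x t) - enn2real (loss \<alpha> f n x t)"

text \<open>
  The initial data are not assumed integrable, so the absolute convergence of the integral defining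
  \<open>S\<^sub>t f\<^sup>0\<close> is stated explicitly: the Bochner integral of a non-integrable function is \<open>0\<close>.  The
  Duhamel integral needs no such clause, since for each \<open>t\<close> it converges absolutely for almost every
  \<open>x\<close> once gain and loss are integrable on \<open>\<real>\<^sup>d \<times> [0,t]\<close>.
\<close>

definition weak_solution :: "(nat \<Rightarrow> real) \<Rightarrow> (nat \<Rightarrow> nat \<Rightarrow> real)
    \<Rightarrow> (nat \<Rightarrow> (real, 'd::finite) vec \<Rightarrow> real)
    \<Rightarrow> (nat \<Rightarrow> (real, 'd) vec \<Rightarrow> real \<Rightarrow> real) \<Rightarrow> bool" where
  "weak_solution D \<alpha> f0 f \<longleftrightarrow>
     (\<forall>n\<ge>1. f0 n \<in> borel_measurable borel \<and> (\<forall>x. 0 \<le> f0 n x)) \<and>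
     (\<forall>n\<ge>1. set_borel_measurable borel (UNIV \<times> {0..}) (\<lambda>(x, t). f n x t) \<and>
            (\<forall>x. \<forall>t\<ge>0. 0 \<le> f n x t)) \<and>
     (\<forall>n\<ge>1. \<forall>T\<ge>0.
        (\<integral>\<^sup>+ p \<in> UNIV \<times> {0..T}. gain \<alpha> f n (fst p) (snd p) \<partial>lborel) < \<infinity> \<and>
        (\<integral>\<^sup>+ p \<in> UNIV \<times> {0..T}. loss \<alpha> f n (fst p) (snd p) \<partial>lborel) < \<infinity>) \<and>
     (\<forall>n\<ge>1. \<forall>t\<ge>0. AE x in lborel.
        (D n * t > 0 \<longrightarrow> integrable lborel (\<lambda>y. heat_kernel (D n * t) (x - y) * f0 n y)) \<and>
        f n x t = heat_semigroup (D n) t (f0 n) x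
          + (LINT s:{0..t}|lborel. heat_semigroup (D n) (t - s) (\<lambda>y. coag \<alpha> f n y s) x))"

definition moment_X :: "(nat \<Rightarrow> (real, 'd::finite) vec \<Rightarrow> real \<Rightarrow> real)
    \<Rightarrow> real \<Rightarrow> (real, 'd) vec \<Rightarrow> real \<Rightarrow> ennreal" where
  "moment_X f a x t = (\<Sum>\<^sub>\<infinity>n\<in>{1..}. ennreal (real n powr a * f n x t))"

definition moment_Y :: "(nat \<Rightarrow> real) \<Rightarrow> (nat \<Rightarrow> (real, 'd::finite) vec \<Rightarrow> real \<Rightarrow> real)
    \<Rightarrow> real \<Rightarrow> (real, 'd) vec \<Rightarrow> real \<Rightarrow> ennreal" where
  "moment_Y D f a x t = (\<Sum>\<^sub>\<infinity>(n, m)\<in>{1..} \<times> {1..}.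
     ennreal (real n * real m * (real n powr a + real m powr a) * (D n + D m) * f n x t * f m x t))"

definition moment_Y_hat :: "(nat \<Rightarrow> nat \<Rightarrow> real) \<Rightarrow> (nat \<Rightarrow> (real, 'd::finite) vec \<Rightarrow> real \<Rightarrow> real)
    \<Rightarrow> real \<Rightarrow> (real, 'd) vec \<Rightarrow> real \<Rightarrow> ennreal" where
  "moment_Y_hat \<alpha> f a x t = (\<Sum>\<^sub>\<infinity>(n, m)\<in>{1..} \<times> {1..}.
     ennreal ((real n powr a * real m + real m powr a * real n) * \<alpha> n m * f n x t * f m x t))"

definition mass :: "(nat \<Rightarrow> (real, 'd::finite) vec \<Rightarrow> real \<Rightarrow> real) \<Rightarrow> real \<Rightarrow> ennreal" where
  "mass f t = (\<Sum>\<^sub>\<infinity>m\<in>{1..}. of_nat m * (\<integral>\<^sup>+ x. ennreal (f m x t) \<partial>lborel))"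

definition conserves_mass_on ::
    "(nat \<Rightarrow> (real, 'd::finite) vec \<Rightarrow> real \<Rightarrow> real) \<Rightarrow> real set \<Rightarrow> bool" where
  "conserves_mass_on f J \<longleftrightarrow> (\<forall>t\<in>J. mass f t = mass f 0)"

end

theory Submission
  imports Defs "HOL-Probability.Distributions"
begin

text \<open>
Every collision preserves mass, so mass can only be lost at infinite size, and it is conserved as
soon as the total mass passing through collisions is finite.  To make this precise, integrate the
Duhamel formula of each species over space.  The heat semigroup preserves the integral of
nonnegative functions, so on every strip \<open>\<real>\<^sup>d \<times> [0,t]\<close> the amount of the species at time \<open>t\<close> plus its
total loss equals the initial amount plus its total gain (\<open>mass_balance\<close>).  Weight this identity by
the size \<open>n\<close> and sum.  Pointwise the two collision series agree, because both are sums of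
\<open>(m + k) \<alpha>(m,k) f\<^sub>m f\<^sub>k\<close> over all pairs (\<open>mass_gain_eq_mass_loss\<close>); if their common integral is finite,
it cancels, and the mass at time \<open>t\<close> is the initial mass.  All of this takes place in the extended
nonnegative reals, so no summability has to be justified and infinite initial mass needs no special
treatment.  Since \<open>n + m \<le> 2 n m\<close>, the common integral is at most the space-time integral of
\<open>moment_Y_hat \<alpha> f 1\<close>, which is part (i).

Part (ii) is reduced to part (i).  As \<open>\<alpha>(n,m) \<le> C\<^sub>0 (n + m)\<close>, this moment is at most
\<open>4 C\<^sub>0 X\<^sub>1 X\<^sub>2\<close>, where \<open>X\<^sub>a\<close> stands for \<open>moment_X f a\<close>, so it suffices that \<open>X\<^sub>1\<close> is bounded and
that the integral of \<open>X\<^sub>2\<close> stays bounded on bounded time intervals.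

\<^item> The bound on \<open>X\<^sub>1\<close> (\<open>first_moment_bound\<close>) comes from a comparison of heat kernels.  Let \<open>d\<close> be
  the dimension.  Multiplied by \<open>(D n)\<^bsup>d/2\<^esup>\<close>, the kernel of species \<open>n\<close> is
  \<open>(4 \<pi> s)\<^bsup>-d/2\<^esup> exp (-|z|\<^sup>2 / (4 s D n))\<close>, which decreases in \<open>n\<close> because \<open>D\<close> does.
  Hence \<open>n\<close> times this kernel is subadditive in \<open>n\<close>, and under subadditive weights collisions can only lose.  In the sum of the Duhamel formulas with weights
  \<open>n (D n)\<^bsup>d/2\<^esup>\<close> the collision terms are therefore nonpositive, and what remains is at most the fastest
  flow applied to \<open>X\<^sub>1(\<cdot>,0)\<close>.  The lower bound on \<open>D\<close> removes the weights again.

\<^item> For \<open>X\<^sub>2\<close> (\<open>second_moment_bound\<close>) a collision of sizes \<open>m\<close> and \<open>k\<close> produces \<open>2 m k\<close> of second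
  moment.  With the bounds on \<open>\<alpha>\<close> and on \<open>X\<^sub>1\<close> this production is at most a constant times \<open>X\<^sub>2\<close>, and a
  Gronwall argument applies.  It is carried out for sums over sizes at most \<open>N\<close>, where everything is
  finite, with bounds that do not depend on \<open>N\<close>.
\<close>

section \<open>Series of extended nonnegative reals\<close>

text \<open>
Series over all natural numbers are easier to handle than sums over the positive ones, and the
summands that occur vanish at index \<open>0\<close>.
\<close>

lemma infsum_from_1_ennreal:
  fixes g :: "nat \<Rightarrow> ennreal"
  assumes "g 0 = 0"
  shows "(\<Sum>\<^sub>\<infinity>n\<in>{1..}. g n) = (\<Sum>n. g n)"
proof -
  have "(\<Sum>\<^sub>\<infinity>n\<in>{1..}. g n) = (\<Sum>\<^sub>\<infinity>n\<in>UNIV. g n)"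
    using assms by (intro infsum_cong_neutral) (auto simp: not_le)
  also have "(g has_sum (\<Sum>\<^sub>\<infinity>n\<in>UNIV. g n)) UNIV"
    by (intro has_sum_infsum nonneg_summable_on_complete) auto
  then have "(\<Sum>\<^sub>\<infinity>n\<in>UNIV. g n) = (\<Sum>n. g n)"
    by (intro sums_unique has_sum_imp_sums)
  finally show ?thesis .
qed

lemma infsum_from_1_prod_ennreal:
  fixes g :: "nat \<times> nat \<Rightarrow> ennreal"
  assumes "\<And>n. g (0, n) = 0" "\<And>n. g (n, 0) = 0"
  shows "(\<Sum>\<^sub>\<infinity>p\<in>{1..} \<times> {1..}. g p) = (\<Sum>n. \<Sum>m. g (n, m))"
proof -
  have "(\<Sum>\<^sub>\<infinity>p\<in>{1..} \<times> {1..}. g p) = (\<Sum>\<^sub>\<infinity>p\<in>UNIV. g p)"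
  proof (intro infsum_cong_neutral)
    fix p :: "nat \<times> nat" assume "p \<in> UNIV - {1..} \<times> {1..}"
    with assms show "g p = 0"
      by (cases p) (auto simp: not_le)
  qed auto
  also have "\<dots> = (\<Sum>\<^sub>\<infinity>n\<in>UNIV. g (prod_decode n))"
    by (rule infsum_reindex_bij_betw[symmetric, OF bij_prod_decode])
  also have "((\<lambda>n. g (prod_decode n)) has_sum (\<Sum>\<^sub>\<infinity>n\<in>UNIV. g (prod_decode n))) UNIV"
    by (intro has_sum_infsum nonneg_summable_on_complete) auto
  then have "(\<Sum>\<^sub>\<infinity>n\<in>UNIV. g (prod_decode n)) = (\<Sum>n. g (prod_decode n))"
    by (intro sums_unique has_sum_imp_sums)
  also have "\<dots> = (\<Sum>n. \<Sum>m. g (n, m))"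
    by (rule suminf_ennreal_2dimen) simp
  finally show ?thesis .
qed

text \<open>
Monotone convergence, with the series over \<open>n\<close> read as an integral over counting measure.
\<close>

lemma suminf_swap_ennreal:
  fixes h :: "nat \<Rightarrow> nat \<Rightarrow> ennreal"
  shows "(\<Sum>n. \<Sum>m. h n m) = (\<Sum>m. \<Sum>n. h n m)"
proof -
  have "(\<Sum>n. \<Sum>m. h n m) = (\<integral>\<^sup>+n. (\<Sum>m. h n m) \<partial>count_space UNIV)"
    by (rule nn_integral_count_space_nat[symmetric])
  also have "\<dots> = (\<Sum>m. \<integral>\<^sup>+n. h n m \<partial>count_space UNIV)"
    by (rule nn_integral_suminf) auto
  finally show ?thesis
    by (simp add: nn_integral_count_space_nat)
qed

text \<open>
This turns the gain terms, which are indexed by the size of the product of a collision, into a sum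
over the pairs of colliding sizes.
\<close>

lemma suminf_antidiagonals_ennreal:
  fixes h :: "nat \<Rightarrow> nat \<Rightarrow> ennreal"
  shows "(\<Sum>n. \<Sum>m\<le>n. h m (n - m)) = (\<Sum>m. \<Sum>k. h m k)"
proof -
  have "(\<Sum>m\<le>n. h m (n - m)) = (\<Sum>m. if m \<le> n then h m (n - m) else 0)" for n
    by (subst suminf_finite[of "{..n}"]) auto
  then have "(\<Sum>n. \<Sum>m\<le>n. h m (n - m)) = (\<Sum>n. \<Sum>m. if m \<le> n then h m (n - m) else 0)"
    by simp
  also have "\<dots> = (\<Sum>m. \<Sum>n. if m \<le> n then h m (n - m) else 0)"
    by (rule suminf_swap_ennreal)
  also have "\<dots> = (\<Sum>m. \<Sum>k. h m k)"
  proof (rule suminf_cong)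
    fix m
    have "(\<Sum>n. if m \<le> n then h m (n - m) else 0) =
        (\<Sum>n. if m \<le> n + m then h m (n + m - m) else 0) + (\<Sum>n<m. if m \<le> n then h m (n - m) else 0)"
      by (rule suminf_offset) simp
    then show "(\<Sum>n. if m \<le> n then h m (n - m) else 0) = (\<Sum>k. h m k)"
      by simp
  qed
  finally show ?thesis .
qed

lemma ennreal_double_product: "c * (x * y + y * x) = (c * 2) * x * (y :: ennreal)"
  by (simp add: mult.assoc mult_2 mult.commute[of y x] distrib_right distrib_left)

lemma ennreal_le_if_add_left_le: "a + b \<le> a + c \<Longrightarrow> a < \<infinity> \<Longrightarrow> b \<le> (c :: ennreal)"
  by (auto simp: ennreal_add_left_cancel_le)

section \<open>The heat kernel acting on nonnegative functions\<close>

lemma heat_kernel_nonneg: "0 \<le> heat_kernel s z"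
  by (simp add: heat_kernel_def)

lemma heat_kernel_commute: "heat_kernel s (x - y) = heat_kernel s (y - x)"
  by (simp add: heat_kernel_def norm_minus_commute)

lemma measurable_heat_kernel [measurable (raw)]:
  assumes [measurable]: "g \<in> borel_measurable M" "h \<in> borel_measurable M"
  shows "(\<lambda>w. heat_kernel (g w) (h w)) \<in> borel_measurable M"
  unfolding heat_kernel_def by measurable

text \<open>
The kernel is a product of centred one-dimensional normal densities of variance \<open>2 s\<close>.
\<close>

lemma nn_integral_heat_kernel:
  assumes "0 < s"
  shows "(\<integral>\<^sup>+z. ennreal (heat_kernel s (z :: (real, 'd::finite) vec)) \<partial>lborel) = 1"
proof -
  define \<sigma> where "\<sigma> = sqrt (2 * s)"
  have \<sigma>: "\<sigma>\<^sup>2 = 2 * s" "\<sigma> > 0"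
    using assms by (auto simp: \<sigma>_def)
  have kernel: "heat_kernel s z = (\<Prod>b\<in>Basis. normal_density 0 \<sigma> (z \<bullet> b))" for z :: "(real, 'd) vec"
  proof -
    have "(norm z)\<^sup>2 = (\<Sum>b\<in>Basis. (z \<bullet> b)\<^sup>2)"
      by (simp add: norm_eq_sqrt_inner euclidean_inner[of z z] power2_eq_square sum_nonneg)
    then have "exp (- (norm z)\<^sup>2 / (4 * s)) = (\<Prod>b\<in>Basis. exp (- (z \<bullet> b)\<^sup>2 / (4 * s)))"
      by (subst exp_sum[symmetric]) (auto simp: sum_negf sum_divide_distrib)
    moreover have "(4 * pi * s) powr (- real CARD('d) / 2)
        = (\<Prod>b\<in>(Basis :: (real, 'd) vec set). 1 / sqrt (2 * pi * \<sigma>\<^sup>2))"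
    proof -
      define q where "q = 4 * pi * s"
      have "q > 0"
        using assms by (simp add: q_def)
      have "(\<Prod>b\<in>(Basis :: (real, 'd) vec set). 1 / sqrt (2 * pi * \<sigma>\<^sup>2)) = (1 / sqrt q) ^ CARD('d)"
        by (simp add: \<sigma> q_def mult.assoc)
      also have "1 / sqrt q = q powr (- 1 / 2)"
        using \<open>q > 0\<close> by (simp add: powr_half_sqrt[symmetric] powr_minus_divide)
      also have "\<dots> ^ CARD('d) = q powr (- real CARD('d) / 2)"
        using \<open>q > 0\<close> by (simp add: powr_realpow[symmetric] powr_powr)
      finally show ?thesis
        by (simp add: q_def)
    qed
    ultimately show ?thesis
      unfolding heat_kernel_def normal_density_def prod.distrib by (simp add: \<sigma>)
  qed
  have 1: "(\<integral>\<^sup>+x. ennreal (normal_density 0 \<sigma> x) \<partial>lborel) = 1"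
    using \<sigma> by (subst nn_integral_eq_integral) auto
  have "(\<integral>\<^sup>+z. ennreal (heat_kernel s (z :: (real, 'd::finite) vec)) \<partial>lborel)
      = (\<integral>\<^sup>+z. (\<Prod>b\<in>Basis. ennreal (normal_density 0 \<sigma> ((z :: (real, 'd) vec) \<bullet> b))) \<partial>lborel)"
    by (simp add: kernel prod_ennreal)
  also have "\<dots> = 1"
    by (subst nn_integral_lborel_prod) (auto simp: 1)
  finally show ?thesis .
qed

lemma nn_integral_heat_kernel_translate:
  assumes "0 < s"
  shows "(\<integral>\<^sup>+x. ennreal (heat_kernel s (x - (y :: (real, 'd::finite) vec))) \<partial>lborel) = 1"
proof -
  have "(\<integral>\<^sup>+x. ennreal (heat_kernel s (x - y)) \<partial>lborel)
      = (\<integral>\<^sup>+x. ennreal (heat_kernel s (x - y)) \<partial>distr lborel borel ((+) y))"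
    by (simp add: lborel_distr_plus)
  also have "\<dots> = (\<integral>\<^sup>+x. ennreal (heat_kernel s (x :: (real, 'd) vec)) \<partial>lborel)"
    by (subst nn_integral_distr) auto
  finally show ?thesis
    using assms by (simp add: nn_integral_heat_kernel)
qed

text \<open>
The heat semigroup on functions with values in \<open>[0,\<infinity>]\<close>, where the integral always exists.  The
semigroup of a signed function is recovered in \<open>heat_semigroup_diff\<close>.
\<close>

definition heat_flow ::
    "real \<Rightarrow> real \<Rightarrow> ((real, 'd::finite) vec \<Rightarrow> ennreal) \<Rightarrow> (real, 'd) vec \<Rightarrow> ennreal" where
  "heat_flow D t u x =
     (if D * t = 0 then u x else \<integral>\<^sup>+y. ennreal (heat_kernel (D * t) (x - y)) * u y \<partial>lborel)"

text \<open>
Joint measurability: the function that is transported may depend on the parameter too.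
\<close>

lemma measurable_heat_flow [measurable (raw)]:
  fixes h :: "'a \<Rightarrow> (real, 'd::finite) vec"
  assumes [measurable]: "k \<in> borel_measurable M" "h \<in> borel_measurable M"
    "(\<lambda>p. u (fst p) (snd p)) \<in> borel_measurable (M \<Otimes>\<^sub>M borel)"
  shows "(\<lambda>w. heat_flow D (k w) (u w) (h w)) \<in> borel_measurable M"
proof -
  have [measurable]: "(\<lambda>w. u w (h w)) \<in> borel_measurable M"
    using measurable_compose[of "\<lambda>w. (w, h w)" M "M \<Otimes>\<^sub>M borel" "\<lambda>p. u (fst p) (snd p)" borel] by simp
  have [measurable]: "(\<lambda>(w, y). u w y) \<in> borel_measurable (M \<Otimes>\<^sub>M lborel)"
    using assms(3) by (simp add: case_prod_beta' cong: measurable_cong_sets)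
  have "(\<lambda>w. \<integral>\<^sup>+y. ennreal (heat_kernel (D * k w) (h w - y)) * u w y \<partial>lborel) \<in> borel_measurable M"
    by (rule lborel.borel_measurable_nn_integral) measurable
  then show ?thesis
    unfolding heat_flow_def by measurable
qed

text \<open>
By Tonelli's theorem, since every translate of the kernel has integral \<open>1\<close>.
\<close>

lemma nn_integral_heat_flow:
  assumes "0 \<le> D * t" and [measurable]: "u \<in> borel_measurable borel"
  shows "(\<integral>\<^sup>+x. heat_flow D t u x \<partial>lborel) = (\<integral>\<^sup>+(x :: (real, 'd::finite) vec). u x \<partial>lborel)"
proof (cases "D * t = 0")
  case False
  have "(\<integral>\<^sup>+x. heat_flow D t u x \<partial>lborel)
      = (\<integral>\<^sup>+x. \<integral>\<^sup>+y. ennreal (heat_kernel (D * t) (x - y)) * u y \<partial>lborel \<partial>lborel)"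
    using False by (simp add: heat_flow_def)
  also have "\<dots> = (\<integral>\<^sup>+y. \<integral>\<^sup>+x. ennreal (heat_kernel (D * t) (x - y)) * u y \<partial>lborel \<partial>lborel)"
    by (rule lborel_pair.Fubini') measurable
  also have "\<dots> = (\<integral>\<^sup>+y. u y \<partial>lborel)"
    using nn_integral_heat_kernel_translate[of "D * t", where 'd = 'd] assms(1) False
    by (subst nn_integral_multc) (auto simp del: mult_eq_0_iff)
  finally show ?thesis .
qed (simp add: heat_flow_def)

lemma cmult_heat_flow:
  assumes [measurable]: "u \<in> borel_measurable borel" and "D * t \<noteq> 0" "0 \<le> a"
  shows "ennreal a * heat_flow D t u x
    = (\<integral>\<^sup>+y. ennreal (a * heat_kernel (D * t) (x - y)) * u y \<partial>lborel)"
  using assms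
  by (simp add: heat_flow_def heat_kernel_nonneg mult.assoc ennreal_mult flip: nn_integral_cmult)

text \<open>
In dimension \<open>d\<close> the factor \<open>D\<^bsup>d/2\<^esup>\<close> cancels the dependence on \<open>D\<close> of the normalising constant of the kernel, so that
\<open>D\<close> survives in the exponential only.  Dividing \<open>D\<close> by a lower bound \<open>c\<close> of the diffusion rates will
make the factor at least \<open>1\<close>.
\<close>

lemma scaled_heat_kernel:
  fixes z :: "(real, 'd::finite) vec"
  assumes "0 < D" "0 < c" "0 < \<tau>"
  shows "(D / c) powr (real CARD('d) / 2) * heat_kernel (D * \<tau>) z
    = (4 * pi * \<tau> * c) powr (- real CARD('d) / 2) * exp (- (norm z)\<^sup>2 / (4 * (D * \<tau>)))"
proof -
  have "(4 * pi * (D * \<tau>)) powr (- real CARD('d) / 2)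
      = ((4 * pi * \<tau> * c) * (D / c)) powr (- real CARD('d) / 2)"
    using assms by (simp add: ac_simps)
  also have "\<dots> = (4 * pi * \<tau> * c) powr (- real CARD('d) / 2) * (D / c) powr (- real CARD('d) / 2)"
    by (rule powr_mult)
  also have "(D / c) powr (- real CARD('d) / 2) = inverse ((D / c) powr (real CARD('d) / 2))"
    by (simp add: powr_minus)
  finally show ?thesis
    using assms by (simp add: heat_kernel_def field_simps)
qed

lemma scaled_heat_kernel_mono:
  fixes z :: "(real, 'd::finite) vec"
  assumes "0 < D" "D \<le> D'" "0 < c" "0 < \<tau>"
  shows "(D / c) powr (real CARD('d) / 2) * heat_kernel (D * \<tau>) z
    \<le> (D' / c) powr (real CARD('d) / 2) * heat_kernel (D' * \<tau>) z"
proof -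
  have "(norm z)\<^sup>2 / (4 * (D' * \<tau>)) \<le> (norm z)\<^sup>2 / (4 * (D * \<tau>))"
    using assms by (intro divide_left_mono mult_left_mono mult_right_mono mult_pos_pos) auto
  then show ?thesis
    using assms by (simp add: scaled_heat_kernel mult_left_mono)
qed

lemma integral_heat_kernel_enn2real:
  assumes [measurable]: "u \<in> borel_measurable borel"
    and fin: "AE y in lborel. u y < \<infinity>" "(\<integral>\<^sup>+y. ennreal (heat_kernel s (x - y)) * u y \<partial>lborel) < \<infinity>"
  shows "integrable lborel (\<lambda>y. heat_kernel s (x - y) * enn2real (u y))" (is ?int)
    and "(LINT y|lborel. heat_kernel s (x - y) * enn2real (u y))
      = enn2real (\<integral>\<^sup>+y. ennreal (heat_kernel s (x - y)) * u y \<partial>lborel)" (is ?eq)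
proof -
  have "(\<integral>\<^sup>+y. ennreal (heat_kernel s (x - y) * enn2real (u y)) \<partial>lborel)
      = (\<integral>\<^sup>+y. ennreal (heat_kernel s (x - y)) * u y \<partial>lborel)"
    using fin(1)
    by (intro nn_integral_cong_AE) (auto simp: ennreal_mult heat_kernel_nonneg elim!: eventually_mono)
  then show ?int ?eq
    using fin(2) by (auto simp: heat_kernel_nonneg integral_eq_nn_integral intro!: integrableI_nonneg)
qed

text \<open>
Both flows are finite at \<open>x\<close>, so the Bochner integral splits.  At the points where \<open>u\<close> or \<open>v\<close> is
infinite \<open>enn2real\<close> returns \<open>0\<close>, but these points form a null set.
\<close>

lemma heat_semigroup_diff:
  assumes [measurable]: "u \<in> borel_measurable borel" "v \<in> borel_measurable borel"
    and fin: "AE y in lborel. u y < \<infinity>" "AE y in lborel. v y < \<infinity>"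
      "heat_flow D t u x < \<infinity>" "heat_flow D t v x < \<infinity>"
  shows "heat_semigroup D t (\<lambda>y. enn2real (u y) - enn2real (v y)) x
    = enn2real (heat_flow D t u x) - enn2real (heat_flow D t v x)"
proof (cases "D * t = 0")
  case False
  note u = integral_heat_kernel_enn2real[of u "D * t" x] and v = integral_heat_kernel_enn2real[of v "D * t" x]
  show ?thesis
    using False fin u v by (simp add: heat_semigroup_def heat_flow_def right_diff_distrib)
qed (auto simp: heat_semigroup_def heat_flow_def)

lemma ennreal_heat_semigroup:
  assumes [measurable]: "u \<in> borel_measurable borel" and "\<And>y. 0 \<le> u y"
    and "D * t \<noteq> 0 \<Longrightarrow> integrable lborel (\<lambda>y. heat_kernel (D * t) (x - y) * u y)"
  shows "ennreal (heat_semigroup D t u x) = heat_flow D t (\<lambda>y. ennreal (u y)) x"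
    and "0 \<le> heat_semigroup D t u x"
  using assms by (auto simp: heat_semigroup_def heat_flow_def heat_kernel_nonneg nn_integral_eq_integral
      simp flip: ennreal_mult)

section \<open>Duhamel integrals over space-time strips\<close>

lemma measurable_uncurried:
  fixes g :: "'a::second_countable_topology \<Rightarrow> 'b::second_countable_topology \<Rightarrow> ennreal"
  assumes "(\<lambda>p. g (fst p) (snd p)) \<in> borel_measurable borel"
    and [measurable]: "h \<in> borel_measurable M" "k \<in> borel_measurable M"
  shows "(\<lambda>w. g (h w) (k w)) \<in> borel_measurable M"
  using measurable_compose[OF _ assms(1), of "\<lambda>w. (h w, k w)" M] by simp

lemma measurable_heat_flow_slices:
  fixes g :: "(real, 'd::finite) vec \<Rightarrow> real \<Rightarrow> ennreal"
  assumes "(\<lambda>p. g (fst p) (snd p)) \<in> borel_measurable borel"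
    and [measurable]: "h \<in> borel_measurable M" "k \<in> borel_measurable M"
  shows "(\<lambda>w. heat_flow D (t - k w) (\<lambda>y. g y (k w)) (h w)) \<in> borel_measurable M"
proof -
  note [measurable (raw)] = measurable_uncurried[OF assms(1)]
  show ?thesis
    by measurable
qed

lemma nn_integral_strip:
  fixes g :: "(real, 'd::finite) vec \<Rightarrow> real \<Rightarrow> ennreal"
  assumes meas: "(\<lambda>p. g (fst p) (snd p)) \<in> borel_measurable borel"
  shows "(\<integral>\<^sup>+p\<in>UNIV \<times> {0..t}. g (fst p) (snd p) \<partial>lborel) = (\<integral>\<^sup>+s\<in>{0..t}. (\<integral>\<^sup>+x. g x s \<partial>lborel) \<partial>lborel)"
proof -
  note [measurable (raw)] = measurable_uncurried[OF meas]
  have "(\<integral>\<^sup>+p\<in>UNIV \<times> {0..t}. g (fst p) (snd p) \<partial>lborel)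
     = (\<integral>\<^sup>+p. g (fst p) (snd p) * indicator {0..t} (snd p) \<partial>(lborel \<Otimes>\<^sub>M lborel))"
    by (subst lborel_prod) (auto simp: indicator_def mem_Times_iff intro!: nn_integral_cong)
  also have "\<dots> = (\<integral>\<^sup>+s. (\<integral>\<^sup>+x. g x s * indicator {0..t} s \<partial>lborel) \<partial>lborel)"
    by (subst lborel_pair.nn_integral_snd[symmetric]) auto
  finally show ?thesis
    by (simp add: nn_integral_multc)
qed

text \<open>
Integrating over \<open>x\<close> first, each time slice is transported without changing its integral.
\<close>

lemma nn_integral_spacetime_heat_flow:
  fixes g :: "(real, 'd::finite) vec \<Rightarrow> real \<Rightarrow> ennreal"
  assumes meas: "(\<lambda>p. g (fst p) (snd p)) \<in> borel_measurable borel" and "0 \<le> D"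
  shows "(\<integral>\<^sup>+x. (\<integral>\<^sup>+s\<in>{0..t}. heat_flow D (t - s) (\<lambda>y. g y s) x \<partial>lborel) \<partial>lborel)
    = (\<integral>\<^sup>+p\<in>UNIV \<times> {0..t}. g (fst p) (snd p) \<partial>lborel)"
proof -
  note [measurable (raw)] = measurable_uncurried[OF meas] measurable_heat_flow_slices[OF meas]
  have "(\<integral>\<^sup>+x. (\<integral>\<^sup>+s\<in>{0..t}. heat_flow D (t - s) (\<lambda>y. g y s) x \<partial>lborel) \<partial>lborel)
      = (\<integral>\<^sup>+s. (\<integral>\<^sup>+x. heat_flow D (t - s) (\<lambda>y. g y s) x * indicator {0..t} s \<partial>lborel) \<partial>lborel)"
    by (rule lborel_pair.Fubini') measurable
  also have "\<dots> = (\<integral>\<^sup>+s\<in>{0..t}. (\<integral>\<^sup>+x. g x s \<partial>lborel) \<partial>lborel)"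
  proof (rule nn_integral_cong)
    fix s
    show "(\<integral>\<^sup>+x. heat_flow D (t - s) (\<lambda>y. g y s) x * indicator {0..t} s \<partial>lborel)
        = (\<integral>\<^sup>+x. g x s \<partial>lborel) * indicator {0..t} s"
    proof (cases "s \<in> {0..t}")
      case True
      then have "0 \<le> D * (t - s)"
        using \<open>0 \<le> D\<close> by simp
      with True show ?thesis
        using nn_integral_heat_flow[of D "t - s" "\<lambda>y. g y s"] by simp
    qed simp
  qed
  finally show ?thesis
    by (simp add: nn_integral_strip[OF meas])
qed

lemma AE_slice_finite:
  fixes g :: "(real, 'd::finite) vec \<Rightarrow> real \<Rightarrow> ennreal"
  assumes meas: "(\<lambda>p. g (fst p) (snd p)) \<in> borel_measurable borel"
    and fin: "(\<integral>\<^sup>+p\<in>UNIV \<times> {0..t}. g (fst p) (snd p) \<partial>lborel) < \<infinity>"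
  shows "AE s in lborel. s \<in> {0..t} \<longrightarrow> (AE y in lborel. g y s < \<infinity>)"
proof -
  note [measurable (raw)] = measurable_uncurried[OF meas]
  have "AE s in lborel. (\<integral>\<^sup>+x. g x s \<partial>lborel) * indicator {0..t} s \<noteq> \<infinity>"
    using fin unfolding nn_integral_strip[OF meas] by (intro nn_integral_PInf_AE) auto
  then show ?thesis
  proof eventually_elim
    case (elim s)
    then show ?case
      using nn_integral_PInf_AE[of "\<lambda>x. g x s" lborel] by (auto simp: less_top)
  qed
qed

lemma AE_duhamel_finite:
  fixes g :: "(real, 'd::finite) vec \<Rightarrow> real \<Rightarrow> ennreal"
  assumes meas: "(\<lambda>p. g (fst p) (snd p)) \<in> borel_measurable borel" and "0 \<le> D"
    and fin: "(\<integral>\<^sup>+p\<in>UNIV \<times> {0..t}. g (fst p) (snd p) \<partial>lborel) < \<infinity>"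
  shows "AE x in lborel. (\<integral>\<^sup>+s\<in>{0..t}. heat_flow D (t - s) (\<lambda>y. g y s) x \<partial>lborel) < \<infinity>"
proof -
  note [measurable] = measurable_heat_flow_slices[OF meas]
  have "AE x in lborel. (\<integral>\<^sup>+s\<in>{0..t}. heat_flow D (t - s) (\<lambda>y. g y s) x \<partial>lborel) \<noteq> \<infinity>"
    using fin nn_integral_spacetime_heat_flow[OF meas \<open>0 \<le> D\<close>]
    by (intro nn_integral_PInf_AE) auto
  then show ?thesis
    by (simp add: less_top)
qed

lemma integral_enn2real_set:
  assumes [measurable]: "u \<in> borel_measurable M" "A \<in> sets M"
    and fin: "(\<integral>\<^sup>+s\<in>A. u s \<partial>M) < \<infinity>"
  shows "set_integrable M A (\<lambda>s. enn2real (u s))" (is ?int)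
    and "(LINT s:A|M. enn2real (u s)) = enn2real (\<integral>\<^sup>+s\<in>A. u s \<partial>M)" (is ?eq)
proof -
  have "AE s in M. u s * indicator A s \<noteq> \<infinity>"
    using fin by (intro nn_integral_PInf_AE) auto
  then have "(\<integral>\<^sup>+s. ennreal (indicator A s *\<^sub>R enn2real (u s)) \<partial>M) = (\<integral>\<^sup>+s\<in>A. u s \<partial>M)"
    by (intro nn_integral_cong_AE) (auto elim!: eventually_mono simp: indicator_def less_top)
  then show ?int ?eq
    using fin unfolding set_integrable_def set_lebesgue_integral_def
    by (auto simp: integral_eq_nn_integral intro!: integrableI_nonneg)
qed

text \<open>
The Duhamel integral of a difference of two integrable sources.  For almost every \<open>x\<close> the flows of both
sources are integrable over \<open>[0,t]\<close>, hence finite for almost every time \<open>s\<close>, and for almost every \<open>s\<close>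
both sources are finite almost everywhere in space; at such \<open>s\<close> the semigroup splits.
\<close>

lemma AE_duhamel_diff:
  fixes g l :: "(real, 'd::finite) vec \<Rightarrow> real \<Rightarrow> ennreal"
  assumes meas: "(\<lambda>p. g (fst p) (snd p)) \<in> borel_measurable borel"
      "(\<lambda>p. l (fst p) (snd p)) \<in> borel_measurable borel" and "0 \<le> D"
    and fin: "(\<integral>\<^sup>+p\<in>UNIV \<times> {0..t}. g (fst p) (snd p) \<partial>lborel) < \<infinity>"
      "(\<integral>\<^sup>+p\<in>UNIV \<times> {0..t}. l (fst p) (snd p) \<partial>lborel) < \<infinity>"
  shows "AE x in lborel.
      (LINT s:{0..t}|lborel. heat_semigroup D (t - s) (\<lambda>y. enn2real (g y s) - enn2real (l y s)) x)
      = enn2real (\<integral>\<^sup>+s\<in>{0..t}. heat_flow D (t - s) (\<lambda>y. g y s) x \<partial>lborel)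
        - enn2real (\<integral>\<^sup>+s\<in>{0..t}. heat_flow D (t - s) (\<lambda>y. l y s) x \<partial>lborel)"
  using AE_duhamel_finite[OF meas(1) \<open>0 \<le> D\<close> fin(1)] AE_duhamel_finite[OF meas(2) \<open>0 \<le> D\<close> fin(2)]
proof eventually_elim
  fix x
  let ?G = "\<lambda>s. heat_flow D (t - s) (\<lambda>y. g y s) x" and ?L = "\<lambda>s. heat_flow D (t - s) (\<lambda>y. l y s) x"
  assume G: "(\<integral>\<^sup>+s\<in>{0..t}. ?G s \<partial>lborel) < \<infinity>" and L: "(\<integral>\<^sup>+s\<in>{0..t}. ?L s \<partial>lborel) < \<infinity>"
  note [measurable (raw)] = measurable_uncurried[OF meas(1)] measurable_uncurried[OF meas(2)]
  have [measurable]: "?G \<in> borel_measurable borel" "?L \<in> borel_measurable borel"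
    by measurable
  have [measurable]: "(\<lambda>s. heat_semigroup D (t - s) (\<lambda>y. enn2real (g y s) - enn2real (l y s)) x) \<in> borel_measurable borel"
    unfolding heat_semigroup_def by measurable
  have "AE s in lborel. ?G s * indicator {0..t} s \<noteq> \<infinity>" "AE s in lborel. ?L s * indicator {0..t} s \<noteq> \<infinity>"
    using G L by (intro nn_integral_PInf_AE; simp)+
  then have "AE s in lborel. s \<in> {0..t} \<longrightarrow>
      heat_semigroup D (t - s) (\<lambda>y. enn2real (g y s) - enn2real (l y s)) x = enn2real (?G s) - enn2real (?L s)"
    using AE_slice_finite[OF meas(1) fin(1)] AE_slice_finite[OF meas(2) fin(2)]
  proof eventually_elim
    case (elim s)
    then show ?case
      using heat_semigroup_diff[of "\<lambda>y. g y s" "\<lambda>y. l y s" D "t - s" x] by (auto simp: less_top)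
  qed
  then have "(LINT s:{0..t}|lborel. heat_semigroup D (t - s) (\<lambda>y. enn2real (g y s) - enn2real (l y s)) x)
      = (LINT s:{0..t}|lborel. enn2real (?G s) - enn2real (?L s))"
    by (intro set_lebesgue_integral_cong_AE) auto
  also have "\<dots> = (LINT s:{0..t}|lborel. enn2real (?G s)) - (LINT s:{0..t}|lborel. enn2real (?L s))"
    using G L by (intro set_integral_diff integral_enn2real_set) auto
  also have "\<dots> = enn2real (\<integral>\<^sup>+s\<in>{0..t}. ?G s \<partial>lborel) - enn2real (\<integral>\<^sup>+s\<in>{0..t}. ?L s \<partial>lborel)"
    using G L by (subst (1 2) integral_enn2real_set) auto
  finally show "(LINT s:{0..t}|lborel. heat_semigroup D (t - s) (\<lambda>y. enn2real (g y s) - enn2real (l y s)) x)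
      = enn2real (\<integral>\<^sup>+s\<in>{0..t}. ?G s \<partial>lborel) - enn2real (\<integral>\<^sup>+s\<in>{0..t}. ?L s \<partial>lborel)" .
qed

section \<open>A Gronwall inequality\<close>

text \<open>
Instead of iterating the inequality, compare with \<open>exp (2 B s)\<close>: let \<open>S\<close> be the supremum of
\<open>exp (-2 B s) v(s)\<close>.  The integral of \<open>exp (2 B r)\<close> over \<open>[0,s]\<close> is at most \<open>exp (2 B s) / (2 B)\<close>, so the
assumption gives \<open>S \<le> A + S / 2\<close>, and \<open>S\<close> is finite by the a priori bound \<open>M\<close>.  The factor \<open>2\<close> is the
price of this shortcut; what matters is that the bound does not involve \<open>M\<close>.
\<close>

lemma gronwall_crude:
  fixes v :: "real \<Rightarrow> ennreal"
  assumes B: "0 < B" and M: "\<And>s. s \<in> {0..T} \<Longrightarrow> v s \<le> M" "M < \<infinity>"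
    and le: "\<And>s. s \<in> {0..T} \<Longrightarrow> v s \<le> A + ennreal B * (\<integral>\<^sup>+r\<in>{0..s}. v r \<partial>lborel)"
    and t: "t \<in> {0..T}"
  shows "v t \<le> 2 * A * ennreal (exp (2 * B * t))"
proof -
  define S where "S = (SUP s\<in>{0..T}. ennreal (exp (- 2 * B * s)) * v s)"
  have exp_cancel: "ennreal (exp (2 * B * s)) * (ennreal (exp (- 2 * B * s)) * y) = y" for s y
    by (simp add: mult_exp_exp flip: mult.assoc ennreal_mult)
  have v_le: "v s \<le> ennreal (exp (2 * B * s)) * S" if "s \<in> {0..T}" for s
  proof -
    have "v s = ennreal (exp (2 * B * s)) * (ennreal (exp (- 2 * B * s)) * v s)"
      by (rule exp_cancel[symmetric])
    also have "\<dots> \<le> ennreal (exp (2 * B * s)) * S"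
      unfolding S_def using that by (intro mult_left_mono SUP_upper) auto
    finally show ?thesis .
  qed
  have "S \<le> M"
    unfolding S_def
  proof (rule SUP_least)
    fix s assume s: "s \<in> {0..T}"
    then have "ennreal (exp (- 2 * B * s)) * v s \<le> 1 * M"
      using B M(1)[OF s] by (intro mult_mono) auto
    then show "ennreal (exp (- 2 * B * s)) * v s \<le> M"
      by simp
  qed
  then have "S < \<infinity>"
    using M(2) by auto
  have exp_int: "ennreal B * (\<integral>\<^sup>+r\<in>{0..s}. ennreal (exp (2 * B * r)) \<partial>lborel) \<le> ennreal (exp (2 * B * s) / 2)"
    if "0 \<le> s" for s
  proof -
    have "(\<integral>\<^sup>+r\<in>{0..s}. ennreal (exp (2 * B * r)) \<partial>lborel)
        = ennreal (exp (2 * B * s) / (2 * B) - exp (2 * B * 0) / (2 * B))"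
      using that B by (intro nn_integral_FTC_Icc) (auto intro!: derivative_eq_intros)
    also have "\<dots> \<le> ennreal (exp (2 * B * s) / (2 * B))"
      using B by (intro ennreal_leI) simp
    finally have "ennreal B * (\<integral>\<^sup>+r\<in>{0..s}. ennreal (exp (2 * B * r)) \<partial>lborel)
        \<le> ennreal B * ennreal (exp (2 * B * s) / (2 * B))"
      by (rule mult_left_mono) simp
    also have "\<dots> = ennreal (exp (2 * B * s) / 2)"
      using B by (simp flip: ennreal_mult)
    finally show ?thesis .
  qed
  have "S \<le> A + S / 2"
    unfolding S_def
  proof (rule SUP_least, fold S_def)
    fix s assume s: "s \<in> {0..T}"
    have "(\<integral>\<^sup>+r\<in>{0..s}. v r \<partial>lborel) \<le> (\<integral>\<^sup>+r\<in>{0..s}. ennreal (exp (2 * B * r)) * S \<partial>lborel)"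
      using s v_le by (intro nn_integral_mono) (auto simp: indicator_def)
    also have "\<dots> = (\<integral>\<^sup>+r\<in>{0..s}. ennreal (exp (2 * B * r)) \<partial>lborel) * S"
      by (subst nn_integral_multc[symmetric]) (auto simp: ac_simps)
    finally have "ennreal B * (\<integral>\<^sup>+r\<in>{0..s}. v r \<partial>lborel)
        \<le> ennreal B * (\<integral>\<^sup>+r\<in>{0..s}. ennreal (exp (2 * B * r)) \<partial>lborel) * S"
      by (simp add: mult.assoc mult_left_mono)
    also have "\<dots> \<le> ennreal (exp (2 * B * s) / 2) * S"
      using s exp_int by (intro mult_right_mono) auto
    finally have "v s \<le> A + ennreal (exp (2 * B * s) / 2) * S"
      using le[OF s] by (meson add_left_mono order_trans)
    then have "ennreal (exp (- 2 * B * s)) * v s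
        \<le> ennreal (exp (- 2 * B * s)) * A + ennreal (exp (- 2 * B * s)) * (ennreal (exp (2 * B * s) / 2) * S)"
      by (metis distrib_left mult_left_mono zero_le)
    also have "ennreal (exp (- 2 * B * s)) * (ennreal (exp (2 * B * s) / 2) * S) = ennreal (1 / 2) * S"
      by (simp add: mult_exp_exp flip: mult.assoc ennreal_mult)
    also have "ennreal (1 / 2) * S = S / 2"
      by (simp add: ennreal_times_divide divide_ennreal_def mult.commute flip: inverse_ennreal ennreal_numeral)
    also have "ennreal (exp (- 2 * B * s)) * A \<le> 1 * A"
      using s B by (intro mult_right_mono) auto
    finally show "ennreal (exp (- 2 * B * s)) * v s \<le> A + S / 2"
      by simp
  qed
  moreover have half: "S / 2 + S / 2 = S"
    unfolding mult_2[symmetric] ennreal_times_divide by (simp add: ennreal_mult_divide_eq mult.commute)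
  ultimately have "S / 2 + S / 2 \<le> S / 2 + A"
    by (simp add: add.commute)
  then have "S / 2 \<le> A"
    by (rule ennreal_le_if_add_left_le) (metis \<open>S < \<infinity>\<close> half le_iff_add le_less_trans)
  then have "S \<le> A + A"
    using add_mono[of "S / 2" A "S / 2" A] by (simp only: half)
  then have "S \<le> 2 * A"
    by (simp only: mult_2)
  then have "ennreal (exp (2 * B * t)) * S \<le> ennreal (exp (2 * B * t)) * (2 * A)"
    by (rule mult_left_mono) simp
  with v_le[OF t] show ?thesis
    by (simp add: mult.commute)
qed

section \<open>Weak solutions and their collision terms\<close>

text \<open>
A weak solution is given for sizes \<open>n \<ge> 1\<close> and times \<open>t \<ge> 0\<close> only.  Here it is taken to be extended by
zero, so that each \<open>f n\<close> is a Borel function on all of space-time and every series may start at \<open>0\<close>.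
\<close>

locale global_weak_solution =
  fixes D :: "nat \<Rightarrow> real"
    and \<alpha> :: "nat \<Rightarrow> nat \<Rightarrow> real"
    and f0 :: "nat \<Rightarrow> (real, 'd::finite) vec \<Rightarrow> real"
    and f :: "nat \<Rightarrow> (real, 'd) vec \<Rightarrow> real \<Rightarrow> real"
  assumes D_nonneg: "\<And>n. n \<ge> 1 \<Longrightarrow> D n \<ge> 0"
    and \<alpha>_nonneg: "\<And>n m. n \<ge> 1 \<Longrightarrow> m \<ge> 1 \<Longrightarrow> \<alpha> n m \<ge> 0"
    and \<alpha>_sym: "\<And>n m. n \<ge> 1 \<Longrightarrow> m \<ge> 1 \<Longrightarrow> \<alpha> n m = \<alpha> m n"
    and weak: "weak_solution D \<alpha> f0 f"
    and f_0 [simp]: "\<And>x t. f 0 x t = 0"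
    and f_nonneg [simp]: "\<And>n x t. 0 \<le> f n x t"
    and measurable_f_pair: "\<And>n. (\<lambda>(x, t). f n x t) \<in> borel_measurable borel"
begin

lemma measurable_f [measurable (raw)]:
  assumes [measurable]: "h \<in> borel_measurable M" "k \<in> borel_measurable M"
  shows "(\<lambda>w. f n (h w) (k w)) \<in> borel_measurable M"
  using measurable_compose[of "\<lambda>w. (h w, k w)" M borel "\<lambda>(x, t). f n x t" borel] measurable_f_pair
  by simp

text \<open>
Pairs of clusters are counted as ordered pairs; a cluster can be lost in either position, whence the
factor \<open>2\<close> in the loss term.
\<close>

definition collision :: "nat \<Rightarrow> nat \<Rightarrow> (real, 'd) vec \<Rightarrow> real \<Rightarrow> ennreal" where
  "collision m k x t = ennreal (\<alpha> m k * f m x t * f k x t)"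

lemma collision_0 [simp]: "collision 0 k x t = 0" "collision k 0 x t = 0"
  by (simp_all add: collision_def)

lemma collision_commute: "collision m k x t = collision k m x t"
  using \<alpha>_sym[of m k] by (cases "m = 0"; cases "k = 0") (auto simp: collision_def ac_simps)

lemma measurable_collision [measurable (raw)]:
  assumes [measurable]: "h \<in> borel_measurable M" "k \<in> borel_measurable M"
  shows "(\<lambda>w. collision n m (h w) (k w)) \<in> borel_measurable M"
  unfolding collision_def by measurable

lemma gain_eq_sum_collision: "gain \<alpha> f n x t = (\<Sum>m\<le>n. collision m (n - m) x t)"
proof -
  have "(\<Sum>m\<le>n. collision m (n - m) x t) = (\<Sum>m=1..<n. collision m (n - m) x t)"
    by (rule sum.mono_neutral_right) (auto simp: not_le Suc_le_eq not_less intro!: Nat.gr0I)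
  also have "\<dots> = gain \<alpha> f n x t"
    unfolding collision_def gain_def using \<alpha>_nonneg by (intro sum_ennreal) (auto simp: Suc_le_eq)
  finally show ?thesis ..
qed

lemma loss_eq_suminf_collision: "loss \<alpha> f n x t = 2 * (\<Sum>m. collision n m x t)"
proof -
  have "ennreal (f n x t) * ennreal (\<alpha> n m * f m x t) = collision n m x t" for m
  proof (cases "n = 0 \<or> m = 0")
    case False
    then show ?thesis
      using \<alpha>_nonneg[of n m] by (simp add: collision_def ac_simps flip: ennreal_mult)
  qed auto
  then show ?thesis
    unfolding loss_def by (subst infsum_from_1_ennreal) (simp_all add: mult.assoc flip: ennreal_suminf_cmult)
qed

lemma measurable_gain [measurable (raw)]:
  assumes [measurable]: "h \<in> borel_measurable M" "k \<in> borel_measurable M"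
  shows "(\<lambda>w. gain \<alpha> f n (h w) (k w)) \<in> borel_measurable M"
  unfolding gain_eq_sum_collision by measurable

lemma measurable_loss [measurable (raw)]:
  assumes [measurable]: "h \<in> borel_measurable M" "k \<in> borel_measurable M"
  shows "(\<lambda>w. loss \<alpha> f n (h w) (k w)) \<in> borel_measurable M"
  unfolding loss_eq_suminf_collision by measurable

lemma measurable_uncurried_gain_loss:
  shows measurable_uncurried_gain: "(\<lambda>p. gain \<alpha> f n (fst p) (snd p)) \<in> borel_measurable borel"
    and measurable_uncurried_loss: "(\<lambda>p. loss \<alpha> f n (fst p) (snd p)) \<in> borel_measurable borel"
  by (intro measurable_gain measurable_loss borel_measurable_continuous_onI continuous_intros)+

text \<open>
A collision of sizes \<open>m\<close> and \<open>k\<close> creates weight \<open>w (m + k)\<close>; by \<open>weighted_loss\<close> it destroys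
\<open>w m + w k\<close>.
\<close>

lemma weighted_gain:
  "(\<Sum>n. w n * gain \<alpha> f n x t) = (\<Sum>m. \<Sum>k. w (m + k) * collision m k x t)"
proof -
  have "(\<Sum>n. w n * gain \<alpha> f n x t) = (\<Sum>n. \<Sum>m\<le>n. w (m + (n - m)) * collision m (n - m) x t)"
    unfolding gain_eq_sum_collision sum_distrib_left by simp
  also have "\<dots> = (\<Sum>m. \<Sum>k. w (m + k) * collision m k x t)"
    by (rule suminf_antidiagonals_ennreal)
  finally show ?thesis .
qed

text \<open>
Relabelling the pair turns one of the two equal halves of the loss term from \<open>w m\<close> into \<open>w k\<close>.
\<close>

lemma weighted_loss:
  "(\<Sum>n. w n * loss \<alpha> f n x t) = (\<Sum>m. \<Sum>k. (w m + w k) * collision m k x t)"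
proof -
  have "(\<Sum>m. \<Sum>k. w k * collision m k x t) = (\<Sum>m. \<Sum>k. w m * collision m k x t)"
    by (subst suminf_swap_ennreal) (simp only: collision_commute)
  then have "(\<Sum>m. \<Sum>k. (w m + w k) * collision m k x t)
      = (\<Sum>m. w m * (\<Sum>k. collision m k x t)) + (\<Sum>m. w m * (\<Sum>k. collision m k x t))"
    by (simp add: distrib_right flip: suminf_add)
  then show ?thesis
    by (simp add: loss_eq_suminf_collision mult_2 distrib_left flip: suminf_add)
qed

lemma mass_gain_eq_mass_loss:
  "(\<Sum>n. of_nat n * gain \<alpha> f n x t) = (\<Sum>n. of_nat n * loss \<alpha> f n x t)"
  by (simp add: weighted_gain weighted_loss)

text \<open>
Setting the weights to \<open>0\<close> beyond \<open>N\<close> preserves the subadditivity up to the error \<open>e\<close>: when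
\<open>m + k > N\<close> the left side vanishes, and otherwise \<open>m\<close> and \<open>k\<close> are themselves at most \<open>N\<close>.  So the
comparison of the full series covers finite sums as well.
\<close>

lemma truncated_weighted_gain_le:
  assumes "\<And>m k. 1 \<le> m \<Longrightarrow> 1 \<le> k \<Longrightarrow> m + k \<le> N \<Longrightarrow> w (m + k) \<le> w m + w k + e m k"
  shows "(\<Sum>n\<le>N. w n * gain \<alpha> f n x t)
    \<le> (\<Sum>n\<le>N. w n * loss \<alpha> f n x t) + (\<Sum>m\<le>N. \<Sum>k\<le>N. e m k * collision m k x t)"
proof -
  define W where "W n = (if n \<le> N then w n else 0)" for n
  define E where "E m k = (if m \<le> N \<and> k \<le> N then e m k else 0)" for m k
  have trunc: "(\<Sum>n\<le>N. w n * g n) = (\<Sum>n. W n * g n)" for g :: "nat \<Rightarrow> ennreal"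
    by (subst suminf_finite[of "{..N}"]) (auto simp: W_def)
  have "(\<Sum>k. E m k * collision m k x t) = (\<Sum>k\<le>N. E m k * collision m k x t)" for m
    by (subst suminf_finite[of "{..N}"]) (auto simp: E_def)
  then have "(\<Sum>m. \<Sum>k. E m k * collision m k x t) = (\<Sum>m. \<Sum>k\<le>N. E m k * collision m k x t)"
    by simp
  also have "\<dots> = (\<Sum>m\<le>N. \<Sum>k\<le>N. E m k * collision m k x t)"
    by (subst suminf_finite[of "{..N}"]) (auto simp: E_def)
  also have "\<dots> = (\<Sum>m\<le>N. \<Sum>k\<le>N. e m k * collision m k x t)"
    by (auto simp: E_def intro!: sum.cong)
  finally have E: "(\<Sum>m. \<Sum>k. E m k * collision m k x t) = (\<Sum>m\<le>N. \<Sum>k\<le>N. e m k * collision m k x t)" .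
  have "W (m + k) * collision m k x t \<le> (W m + W k) * collision m k x t + E m k * collision m k x t" for m k
  proof (cases "m = 0 \<or> k = 0")
    case False
    then have "W (m + k) \<le> W m + W k + E m k"
      using assms[of m k] by (auto simp: W_def E_def)
    then show ?thesis
      by (metis distrib_right mult_right_mono zero_le)
  qed auto
  then have "(\<Sum>m. \<Sum>k. W (m + k) * collision m k x t)
      \<le> (\<Sum>m. \<Sum>k. (W m + W k) * collision m k x t + E m k * collision m k x t)"
    by (intro suminf_le) auto
  also have "\<dots> = (\<Sum>n. W n * loss \<alpha> f n x t) + (\<Sum>m. \<Sum>k. E m k * collision m k x t)"
    by (simp add: weighted_loss flip: suminf_add)
  finally show ?thesis
    by (simp add: trunc weighted_gain E)
qed

section \<open>The mass balance of a single species\<close>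

lemma initial_datum:
  assumes "1 \<le> n"
  shows measurable_initial: "f0 n \<in> borel_measurable borel" and initial_nonneg: "0 \<le> f0 n x"
  using weak assms by (auto simp: weak_solution_def)

lemma gain_loss_integrable:
  assumes "1 \<le> n" "0 \<le> t"
  shows gain_integrable: "(\<integral>\<^sup>+p\<in>UNIV \<times> {0..t}. gain \<alpha> f n (fst p) (snd p) \<partial>lborel) < \<infinity>"
    and loss_integrable: "(\<integral>\<^sup>+p\<in>UNIV \<times> {0..t}. loss \<alpha> f n (fst p) (snd p) \<partial>lborel) < \<infinity>"
  using weak assms by (auto simp: weak_solution_def)

text \<open>
Moving the loss to the left leaves nonnegative terms only, so the formula can be integrated and summed
without further convergence conditions.
\<close>

lemma duhamel_ennreal:
  assumes n: "1 \<le> n" and t: "0 \<le> t"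
  shows "AE x in lborel.
    ennreal (f n x t) + (\<integral>\<^sup>+s\<in>{0..t}. heat_flow (D n) (t - s) (\<lambda>y. loss \<alpha> f n y s) x \<partial>lborel)
    = heat_flow (D n) t (\<lambda>y. ennreal (f0 n y)) x
      + (\<integral>\<^sup>+s\<in>{0..t}. heat_flow (D n) (t - s) (\<lambda>y. gain \<alpha> f n y s) x \<partial>lborel)"
proof -
  have D: "0 \<le> D n"
    using D_nonneg n by simp
  note meas = measurable_uncurried_gain[of n] measurable_uncurried_loss[of n]
  note fin = gain_integrable[OF n t] loss_integrable[OF n t]
  have "AE x in lborel.
        (D n * t > 0 \<longrightarrow> integrable lborel (\<lambda>y. heat_kernel (D n * t) (x - y) * f0 n y)) \<and>
        f n x t = heat_semigroup (D n) t (f0 n) x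
          + (LINT s:{0..t}|lborel. heat_semigroup (D n) (t - s) (\<lambda>y. coag \<alpha> f n y s) x)"
    using weak n t by (auto simp: weak_solution_def)
  then show ?thesis
    using AE_duhamel_diff[OF meas D fin] AE_duhamel_finite[OF meas(1) D fin(1)] AE_duhamel_finite[OF meas(2) D fin(2)]
  proof eventually_elim
    fix x
    let ?G = "\<integral>\<^sup>+s\<in>{0..t}. heat_flow (D n) (t - s) (\<lambda>y. gain \<alpha> f n y s) x \<partial>lborel"
    let ?L = "\<integral>\<^sup>+s\<in>{0..t}. heat_flow (D n) (t - s) (\<lambda>y. loss \<alpha> f n y s) x \<partial>lborel"
    let ?S = "heat_semigroup (D n) t (f0 n) x"
    assume *: "(D n * t > 0 \<longrightarrow> integrable lborel (\<lambda>y. heat_kernel (D n * t) (x - y) * f0 n y)) \<and>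
        f n x t = ?S + (LINT s:{0..t}|lborel. heat_semigroup (D n) (t - s) (\<lambda>y. coag \<alpha> f n y s) x)"
      and diff: "(LINT s:{0..t}|lborel. heat_semigroup (D n) (t - s)
          (\<lambda>y. enn2real (gain \<alpha> f n y s) - enn2real (loss \<alpha> f n y s)) x) = enn2real ?G - enn2real ?L"
      and G: "?G < \<infinity>" and L: "?L < \<infinity>"
    have "0 \<le> D n * t"
      using D t by simp
    then have S: "ennreal ?S = heat_flow (D n) t (\<lambda>y. ennreal (f0 n y)) x" "0 \<le> ?S"
      using * initial_datum[OF n] by (auto intro!: ennreal_heat_semigroup simp: less_le)
    have "f n x t + enn2real ?L = ?S + enn2real ?G"
      using * diff by (simp add: coag_def)
    then have "ennreal (f n x t) + ennreal (enn2real ?L) = ennreal ?S + ennreal (enn2real ?G)"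
      using S(2) by (simp flip: ennreal_plus)
    with S(1) G L show "ennreal (f n x t) + ?L = heat_flow (D n) t (\<lambda>y. ennreal (f0 n y)) x + ?G"
      by simp
  qed
qed

lemma mass_balance:
  assumes n: "1 \<le> n" and t: "0 \<le> t"
  shows "(\<integral>\<^sup>+x. ennreal (f n x t) \<partial>lborel) + (\<integral>\<^sup>+p\<in>UNIV \<times> {0..t}. loss \<alpha> f n (fst p) (snd p) \<partial>lborel)
    = (\<integral>\<^sup>+x. ennreal (f0 n x) \<partial>lborel) + (\<integral>\<^sup>+p\<in>UNIV \<times> {0..t}. gain \<alpha> f n (fst p) (snd p) \<partial>lborel)"
proof -
  have D: "0 \<le> D n"
    using D_nonneg n by simp
  note meas = measurable_uncurried_gain[of n] measurable_uncurried_loss[of n]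
  note [measurable] = measurable_initial[OF n] measurable_heat_flow_slices[OF meas(1)] measurable_heat_flow_slices[OF meas(2)]
  show ?thesis
    using nn_integral_cong_AE[OF duhamel_ennreal[OF n t]] D t
    by (simp add: nn_integral_add nn_integral_spacetime_heat_flow[OF meas(1) D]
        nn_integral_spacetime_heat_flow[OF meas(2) D] nn_integral_heat_flow)
qed

lemma AE_initial:
  assumes n: "1 \<le> n"
  shows "AE x in lborel. f n x 0 = f0 n x"
  using duhamel_ennreal[OF n order_refl]
proof eventually_elim
  case (elim x)
  then show ?case
    using initial_nonneg[OF n, of x] by (simp add: heat_flow_def nn_integral_null_set)
qed

lemma nn_integral_initial:
  assumes "1 \<le> n"
  shows "(\<integral>\<^sup>+x. ennreal (f n x 0) \<partial>lborel) = (\<integral>\<^sup>+x. ennreal (f0 n x) \<partial>lborel)"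
  using AE_initial[OF assms] by (intro nn_integral_cong_AE) (auto elim: eventually_mono)

section \<open>Conservation of mass when the total mass loss is finite\<close>

lemma mass_eq_suminf: "mass f t = (\<Sum>n. of_nat n * (\<integral>\<^sup>+x. ennreal (f n x t) \<partial>lborel))"
  unfolding mass_def by (rule infsum_from_1_ennreal) simp

text \<open>
The weighted sum of the mass balances, with equal total gain and loss, which cancel when finite.
\<close>

lemma mass_conserved_if_loss_integrable:
  assumes t: "0 \<le> t"
    and fin: "(\<integral>\<^sup>+p\<in>UNIV \<times> {0..t}. (\<Sum>n. of_nat n * loss \<alpha> f n (fst p) (snd p)) \<partial>lborel) < \<infinity>"
  shows "mass f t = mass f 0"
proof -
  note [measurable] = measurable_uncurried_gain measurable_uncurried_loss
  define G where "G n = (\<integral>\<^sup>+p\<in>UNIV \<times> {0..t}. gain \<alpha> f n (fst p) (snd p) \<partial>lborel)" for n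
  define L where "L n = (\<integral>\<^sup>+p\<in>UNIV \<times> {0..t}. loss \<alpha> f n (fst p) (snd p) \<partial>lborel)" for n
  have strip [measurable]: "UNIV \<times> {0..t} \<in> sets (borel :: ((real, 'd) vec \<times> real) measure)"
    by (intro borel_closed closed_Times) auto
  have G: "(\<Sum>n. of_nat n * G n) = (\<integral>\<^sup>+p\<in>UNIV \<times> {0..t}. (\<Sum>n. of_nat n * gain \<alpha> f n (fst p) (snd p)) \<partial>lborel)"
    unfolding G_def by (simp add: nn_integral_suminf mult.assoc flip: nn_integral_cmult ennreal_suminf_multc)
  have L: "(\<Sum>n. of_nat n * L n) = (\<integral>\<^sup>+p\<in>UNIV \<times> {0..t}. (\<Sum>n. of_nat n * loss \<alpha> f n (fst p) (snd p)) \<partial>lborel)"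
    unfolding L_def by (simp add: nn_integral_suminf mult.assoc flip: nn_integral_cmult ennreal_suminf_multc)
  have "of_nat n * (\<integral>\<^sup>+x. ennreal (f n x t) \<partial>lborel) + of_nat n * L n
      = of_nat n * (\<integral>\<^sup>+x. ennreal (f n x 0) \<partial>lborel) + of_nat n * G n" for n
    using mass_balance[of n t] nn_integral_initial[of n] t
    by (cases "n = 0") (simp_all add: G_def L_def flip: distrib_left)
  then have "mass f t + (\<Sum>n. of_nat n * L n) = mass f 0 + (\<Sum>n. of_nat n * G n)"
    by (simp add: mass_eq_suminf suminf_add)
  moreover have "(\<Sum>n. of_nat n * G n) = (\<Sum>n. of_nat n * L n)"
    by (simp add: G L mass_gain_eq_mass_loss)
  moreover have "(\<Sum>n. of_nat n * L n) < \<infinity>"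
    using fin by (simp add: L)
  ultimately show ?thesis
    by (metis add.commute ennreal_add_left_cancel less_irrefl infinity_ennreal_def)
qed

lemma moment_Y_hat_1_eq:
  "moment_Y_hat \<alpha> f 1 x t = (\<Sum>n. \<Sum>m. ennreal (2 * real n * real m) * collision n m x t)"
proof -
  have "moment_Y_hat \<alpha> f 1 x t = (\<Sum>n. \<Sum>m. (case (n, m) of (n, m) \<Rightarrow>
      ennreal ((real n powr 1 * real m + real m powr 1 * real n) * \<alpha> n m * f n x t * f m x t)))"
    unfolding moment_Y_hat_def by (rule infsum_from_1_prod_ennreal) auto
  also have "\<dots> = (\<Sum>n. \<Sum>m. ennreal (2 * real n * real m) * collision n m x t)"
    by (intro suminf_cong) (simp add: collision_def algebra_simps flip: ennreal_mult')
  finally show ?thesis .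
qed

lemma measurable_moment_Y_hat_1 [measurable (raw)]:
  assumes [measurable]: "h \<in> borel_measurable M" "k \<in> borel_measurable M"
  shows "(\<lambda>w. moment_Y_hat \<alpha> f 1 (h w) (k w)) \<in> borel_measurable M"
  unfolding moment_Y_hat_1_eq by measurable

text \<open>
As series over pairs of sizes, both sides differ only in the weight of a pair, which is \<open>n + m\<close> on the left
and \<open>2 n m\<close> on the right.
\<close>

lemma mass_loss_le_moment_Y_hat: "(\<Sum>n. of_nat n * loss \<alpha> f n x t) \<le> moment_Y_hat \<alpha> f 1 x t"
  unfolding weighted_loss moment_Y_hat_1_eq
proof (intro suminf_le summableI)
  fix n m
  show "(of_nat n + of_nat m) * collision n m x t \<le> ennreal (2 * real n * real m) * collision n m x t"
  proof (cases "n = 0 \<or> m = 0")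
    case False
    then have "n \<le> n * m" "m \<le> n * m"
      by auto
    then have "n + m \<le> 2 * n * m"
      by linarith
    then have "real n + real m \<le> 2 * real n * real m"
      by (metis of_nat_add of_nat_le_iff of_nat_mult of_nat_numeral)
    then have "of_nat n + of_nat m \<le> ennreal (2 * real n * real m)"
      unfolding ennreal_of_nat_eq_real_of_nat by (simp add: ennreal_leI flip: ennreal_plus)
    then show ?thesis
      by (rule mult_right_mono) simp
  qed auto
qed

theorem mass_conserved_if_moment_Y_hat_integrable:
  assumes fin: "(\<integral>\<^sup>+t\<in>{0..T}. (\<integral>\<^sup>+x. moment_Y_hat \<alpha> f 1 x t \<partial>lborel) \<partial>lborel) < \<infinity>"
  shows "conserves_mass_on f {0..T}"
  unfolding conserves_mass_on_def
proof
  fix t assume t: "t \<in> {0..T}"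
  have meas: "(\<lambda>p. moment_Y_hat \<alpha> f 1 (fst p) (snd p)) \<in> borel_measurable borel"
    by (intro measurable_moment_Y_hat_1 borel_measurable_continuous_onI continuous_intros)
  have "(\<integral>\<^sup>+p\<in>UNIV \<times> {0..t}. (\<Sum>n. of_nat n * loss \<alpha> f n (fst p) (snd p)) \<partial>lborel)
      \<le> (\<integral>\<^sup>+p\<in>UNIV \<times> {0..t}. moment_Y_hat \<alpha> f 1 (fst p) (snd p) \<partial>lborel)"
    by (intro nn_integral_mono mult_right_mono mass_loss_le_moment_Y_hat) simp
  also have "\<dots> \<le> (\<integral>\<^sup>+p\<in>UNIV \<times> {0..T}. moment_Y_hat \<alpha> f 1 (fst p) (snd p) \<partial>lborel)"
    using t by (intro nn_integral_mono) (auto simp: indicator_def)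
  also have "\<dots> < \<infinity>"
    using fin by (simp add: nn_integral_strip[OF meas])
  finally show "mass f t = mass f 0"
    using t by (intro mass_conserved_if_loss_integrable) auto
qed

section \<open>A uniform bound on the mass density\<close>

lemma moment_X_eq_suminf: "moment_X f a x t = (\<Sum>n. ennreal (real n powr a * f n x t))"
  unfolding moment_X_def by (rule infsum_from_1_ennreal) simp

lemma measurable_moment_X [measurable (raw)]:
  assumes [measurable]: "h \<in> borel_measurable M" "k \<in> borel_measurable M"
  shows "(\<lambda>w. moment_X f a (h w) (k w)) \<in> borel_measurable M"
  unfolding moment_X_eq_suminf by measurable

text \<open>
For fixed \<open>x\<close> and \<open>y\<close> the scaled kernels decrease in \<open>n\<close>, so \<open>n\<close> times the kernel is subadditive in \<open>n\<close>,
and \<open>truncated_weighted_gain_le\<close> applies without an error term at every point \<open>y\<close>.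
\<close>

lemma scaled_flow_gain_le_loss:
  assumes c: "0 < c" "\<And>n. 1 \<le> n \<Longrightarrow> c \<le> D n"
    and decr: "\<And>n m. 1 \<le> n \<Longrightarrow> n \<le> m \<Longrightarrow> D m \<le> D n"
    and \<tau>: "0 < \<tau>"
  defines "w n \<equiv> ennreal (real n * (D n / c) powr (real CARD('d) / 2))"
  shows "(\<Sum>n\<le>N. w n * heat_flow (D n) \<tau> (\<lambda>y. gain \<alpha> f n y s) x)
    \<le> (\<Sum>n\<le>N. w n * heat_flow (D n) \<tau> (\<lambda>y. loss \<alpha> f n y s) x)"
proof -
  define k where "k n z = (D n / c) powr (real CARD('d) / 2) * heat_kernel (D n * \<tau>) z" for n and z :: "(real, 'd) vec"
  have flow: "w n * heat_flow (D n) \<tau> u x = (\<integral>\<^sup>+y. ennreal (real n * k n (x - y)) * u y \<partial>lborel)"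
    if [measurable]: "u \<in> borel_measurable borel" for n u
  proof (cases "n = 0")
    case False
    then have "D n * \<tau> \<noteq> 0"
      using c(1) c(2)[of n] \<tau> by auto
    then show ?thesis
      unfolding w_def k_def by (subst cmult_heat_flow) (simp_all add: mult.assoc)
  qed (simp add: w_def)
  have k_mono: "k n z \<le> k m z" if "1 \<le> m" "m \<le> n" for n m z
    unfolding k_def using that c(1) c(2)[of n] decr[of m n] \<tau> by (intro scaled_heat_kernel_mono) auto
  have "(\<Sum>n\<le>N. ennreal (real n * k n z) * gain \<alpha> f n y s)
      \<le> (\<Sum>n\<le>N. ennreal (real n * k n z) * loss \<alpha> f n y s)" for z y
  proof -
    have "(\<Sum>n\<le>N. ennreal (real n * k n z) * gain \<alpha> f n y s)
      \<le> (\<Sum>n\<le>N. ennreal (real n * k n z) * loss \<alpha> f n y s) + (\<Sum>m\<le>N. \<Sum>j\<le>N. 0 * collision m j y s)"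
    proof (rule truncated_weighted_gain_le)
      fix m j :: nat assume mj: "1 \<le> m" "1 \<le> j"
      have "real (m + j) * k (m + j) z = real m * k (m + j) z + real j * k (m + j) z"
        by (simp add: distrib_right)
      also have "\<dots> \<le> real m * k m z + real j * k j z"
        using mj by (intro add_mono mult_left_mono k_mono) auto
      finally show "ennreal (real (m + j) * k (m + j) z) \<le> ennreal (real m * k m z) + ennreal (real j * k j z) + 0"
        by (simp add: k_def heat_kernel_nonneg ennreal_leI flip: ennreal_plus)
    qed
    then show ?thesis by simp
  qed
  then have "(\<integral>\<^sup>+y. (\<Sum>n\<le>N. ennreal (real n * k n (x - y)) * gain \<alpha> f n y s) \<partial>lborel)
      \<le> (\<integral>\<^sup>+y. (\<Sum>n\<le>N. ennreal (real n * k n (x - y)) * loss \<alpha> f n y s) \<partial>lborel)"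
    by (intro nn_integral_mono)
  then show ?thesis
    by (simp add: flow nn_integral_sum k_def)
qed

text \<open>
The scaled kernel of size \<open>1\<close> dominates all others; it can be taken out of the sum, which leaves the
bounded function \<open>X\<^sub>1(\<cdot>,0)\<close>.
\<close>

lemma scaled_flow_initial_le:
  assumes c: "0 < c" "\<And>n. 1 \<le> n \<Longrightarrow> c \<le> D n"
    and decr: "\<And>n m. 1 \<le> n \<Longrightarrow> n \<le> m \<Longrightarrow> D m \<le> D n"
    and t: "0 < t"
    and X1: "AE x in lborel. moment_X f 1 x 0 \<le> ennreal C"
  defines "w n \<equiv> ennreal (real n * (D n / c) powr (real CARD('d) / 2))"
  shows "(\<Sum>n\<le>N. w n * heat_flow (D n) t (\<lambda>y. ennreal (f n y 0)) x)
    \<le> ennreal ((D 1 / c) powr (real CARD('d) / 2)) * ennreal C"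
proof -
  define k where "k n z = (D n / c) powr (real CARD('d) / 2) * heat_kernel (D n * t) z" for n and z :: "(real, 'd) vec"
  have flow: "w n * heat_flow (D n) t u x = (\<integral>\<^sup>+y. ennreal (real n * k n (x - y)) * u y \<partial>lborel)"
    if [measurable]: "u \<in> borel_measurable borel" for n u
  proof (cases "n = 0")
    case False
    then have "D n * t \<noteq> 0"
      using c(1) c(2)[of n] t by auto
    then show ?thesis
      unfolding w_def k_def by (subst cmult_heat_flow) (simp_all add: mult.assoc)
  qed (simp add: w_def)
  have "(\<Sum>n\<le>N. w n * heat_flow (D n) t (\<lambda>y. ennreal (f n y 0)) x)
      = (\<integral>\<^sup>+y. (\<Sum>n\<le>N. ennreal (real n * k n (x - y)) * ennreal (f n y 0)) \<partial>lborel)"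
    by (simp add: flow nn_integral_sum k_def del: sum_ennreal)
  also have "\<dots> \<le> (\<integral>\<^sup>+y. ennreal (k 1 (x - y)) * ennreal C \<partial>lborel)"
  proof (rule nn_integral_mono_AE)
    show "AE y in lborel. (\<Sum>n\<le>N. ennreal (real n * k n (x - y)) * ennreal (f n y 0)) \<le> ennreal (k 1 (x - y)) * ennreal C"
      using X1
    proof eventually_elim
      case (elim y)
      have "(\<Sum>n\<le>N. ennreal (real n * k n (x - y)) * ennreal (f n y 0))
          \<le> (\<Sum>n\<le>N. ennreal (k 1 (x - y)) * ennreal (real n powr 1 * f n y 0))"
      proof (rule sum_mono)
        fix n
        show "ennreal (real n * k n (x - y)) * ennreal (f n y 0) \<le> ennreal (k 1 (x - y)) * ennreal (real n powr 1 * f n y 0)"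
        proof (cases "n = 0")
          case False
          then have "k n (x - y) \<le> k 1 (x - y)"
            unfolding k_def using c(1) c(2)[of n] decr[of 1 n] t by (intro scaled_heat_kernel_mono) auto
          then have "real n * f n y 0 * k n (x - y) \<le> real n * f n y 0 * k 1 (x - y)"
            by (intro mult_left_mono) auto
          then show ?thesis
            by (simp add: k_def heat_kernel_nonneg ennreal_leI ac_simps flip: ennreal_mult)
        qed simp
      qed
      also have "\<dots> \<le> ennreal (k 1 (x - y)) * moment_X f 1 y 0"
        unfolding moment_X_eq_suminf sum_distrib_left[symmetric] by (intro mult_left_mono sum_le_suminf) auto
      also have "\<dots> \<le> ennreal (k 1 (x - y)) * ennreal C"
        by (intro mult_left_mono elim) simp
      finally show ?case .
    qed
  qed
  also have "\<dots> = ennreal ((D 1 / c) powr (real CARD('d) / 2))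
      * (\<integral>\<^sup>+y. ennreal (heat_kernel (D 1 * t) (y - x)) \<partial>lborel) * ennreal C"
    unfolding k_def by (simp add: nn_integral_multc nn_integral_cmult ennreal_mult heat_kernel_nonneg heat_kernel_commute[of _ x])
  also have "(\<integral>\<^sup>+y. ennreal (heat_kernel (D 1 * t) (y - x)) \<partial>lborel) = 1"
    using c(1) c(2)[of 1] t by (intro nn_integral_heat_kernel_translate) auto
  finally show ?thesis by simp
qed

text \<open>
Sum the Duhamel formulas over sizes at most \<open>N\<close> with weights \<open>n (D n / c)\<^bsup>d/2\<^esup>\<close> in dimension \<open>d\<close>.  The gain is dominated by
the loss, which is finite and cancels, and the initial term is bounded.  The weights are at least \<open>n\<close>.
\<close>

lemma first_moment_bound:
  assumes c: "0 < c" "\<And>n. 1 \<le> n \<Longrightarrow> c \<le> D n"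
    and decr: "\<And>n m. 1 \<le> n \<Longrightarrow> n \<le> m \<Longrightarrow> D m \<le> D n"
    and t: "0 < t"
    and X1: "AE x in lborel. moment_X f 1 x 0 \<le> ennreal C"
  shows "AE x in lborel. moment_X f 1 x t \<le> ennreal ((D 1 / c) powr (real CARD('d) / 2)) * ennreal C"
proof -
  define w where "w n = ennreal (real n * (D n / c) powr (real CARD('d) / 2))" for n
  define G where "G n x = (\<integral>\<^sup>+s\<in>{0..t}. heat_flow (D n) (t - s) (\<lambda>y. gain \<alpha> f n y s) x \<partial>lborel)" for n x
  define L where "L n x = (\<integral>\<^sup>+s\<in>{0..t}. heat_flow (D n) (t - s) (\<lambda>y. loss \<alpha> f n y s) x \<partial>lborel)" for n x
  define I where "I n x = heat_flow (D n) t (\<lambda>y. ennreal (f n y 0)) x" for n x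
  have "AE x in lborel. \<forall>n\<ge>1. ennreal (f n x t) + L n x = I n x + G n x \<and> L n x < \<infinity>"
  proof -
    have "AE x in lborel. ennreal (f n x t) + L n x = I n x + G n x \<and> L n x < \<infinity>" if n: "1 \<le> n" for n
    proof -
      have t': "0 \<le> t" and D: "0 \<le> D n"
        using t D_nonneg[OF n] by auto
      have nz: "D n * t \<noteq> 0"
        using c(1) c(2)[OF n] t by auto
      have flow0: "heat_flow (D n) t (\<lambda>y. ennreal (f0 n y)) x = I n x" for x
        unfolding I_def heat_flow_def using nz AE_initial[OF n]
        by (auto intro!: nn_integral_cong_AE elim!: eventually_mono)
      show ?thesis
        using duhamel_ennreal[OF n t'] AE_duhamel_finite[OF measurable_uncurried_loss D loss_integrable[OF n t']]
        unfolding flow0 G_def L_def by eventually_elim simp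
    qed
    then show ?thesis
      unfolding AE_all_countable by (auto simp: AE_conj_iff)
  qed
  then show ?thesis
  proof eventually_elim
    case (elim x)
    have G_le_L: "(\<Sum>n\<le>N. w n * G n x) \<le> (\<Sum>n\<le>N. w n * L n x)" for N
    proof -
      have pull_out: "(\<integral>\<^sup>+s\<in>{0..t}. (\<Sum>n\<le>N. w n * h n s) \<partial>lborel) = (\<Sum>n\<le>N. w n * (\<integral>\<^sup>+s\<in>{0..t}. h n s \<partial>lborel))"
        if [measurable]: "\<And>n. h n \<in> borel_measurable borel" for h
        by (simp add: sum_distrib_right nn_integral_sum nn_integral_cmult mult.assoc)
      have meas: "(\<lambda>s. heat_flow (D n) (t - s) (\<lambda>y. gain \<alpha> f n y s) x) \<in> borel_measurable borel"
          "(\<lambda>s. heat_flow (D n) (t - s) (\<lambda>y. loss \<alpha> f n y s) x) \<in> borel_measurable borel" for n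
        by (rule measurable_heat_flow_slices[OF measurable_uncurried_gain]
            measurable_heat_flow_slices[OF measurable_uncurried_loss]; simp)+
      have "(\<integral>\<^sup>+s\<in>{0..t}. (\<Sum>n\<le>N. w n * heat_flow (D n) (t - s) (\<lambda>y. gain \<alpha> f n y s) x) \<partial>lborel)
        \<le> (\<integral>\<^sup>+s\<in>{0..t}. (\<Sum>n\<le>N. w n * heat_flow (D n) (t - s) (\<lambda>y. loss \<alpha> f n y s) x) \<partial>lborel)"
      proof (rule nn_integral_mono_AE)
        \<comment> \<open>At \<open>s = t\<close> the flow is the identity and there is no kernel to compare.\<close>
        have "AE s in lborel. s \<noteq> t"
          by (rule AE_lborel_singleton)
        then show "AE s in lborel. (\<Sum>n\<le>N. w n * heat_flow (D n) (t - s) (\<lambda>y. gain \<alpha> f n y s) x) * indicator {0..t} s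
          \<le> (\<Sum>n\<le>N. w n * heat_flow (D n) (t - s) (\<lambda>y. loss \<alpha> f n y s) x) * indicator {0..t} s"
        proof eventually_elim
          case (elim s)
          then show ?case
            using scaled_flow_gain_le_loss[OF c decr, where \<tau> = "t - s" and N = N and s = s and x = x]
            by (auto simp: indicator_def w_def)
        qed
      qed
      then show ?thesis
        by (simp only: G_def L_def pull_out[OF meas(1)] pull_out[OF meas(2)])
    qed
    have partial_sum_le: "(\<Sum>n\<le>N. ennreal (real n powr 1 * f n x t)) \<le> ennreal ((D 1 / c) powr (real CARD('d) / 2)) * ennreal C" for N
    proof -
      have "w n * ennreal (f n x t) + w n * L n x = w n * I n x + w n * G n x" for n
        using elim[rule_format, of n] by (cases "n = 0") (simp_all add: w_def flip: distrib_left)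
      then have "(\<Sum>n\<le>N. w n * L n x) + (\<Sum>n\<le>N. w n * ennreal (f n x t)) = (\<Sum>n\<le>N. w n * I n x) + (\<Sum>n\<le>N. w n * G n x)"
        by (simp add: add.commute flip: sum.distrib)
      also have "\<dots> \<le> (\<Sum>n\<le>N. w n * I n x) + (\<Sum>n\<le>N. w n * L n x)"
        by (intro add_left_mono G_le_L)
      also have "\<dots> = (\<Sum>n\<le>N. w n * L n x) + (\<Sum>n\<le>N. w n * I n x)"
        by (rule add.commute)
      finally have "(\<Sum>n\<le>N. w n * ennreal (f n x t)) \<le> (\<Sum>n\<le>N. w n * I n x)"
      proof (rule ennreal_le_if_add_left_le)
        have "w n * L n x < \<infinity>" for n
          using elim[rule_format, of n] by (cases "n = 0") (simp_all add: w_def ennreal_mult_less_top)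
        then show "(\<Sum>n\<le>N. w n * L n x) < \<infinity>"
          by simp
      qed
      also have "\<dots> \<le> ennreal ((D 1 / c) powr (real CARD('d) / 2)) * ennreal C"
        unfolding I_def w_def by (rule scaled_flow_initial_le[OF c decr t X1])
      finally have "(\<Sum>n\<le>N. w n * ennreal (f n x t)) \<le> ennreal ((D 1 / c) powr (real CARD('d) / 2)) * ennreal C" .
      moreover
      have "ennreal (real n powr 1 * f n x t) \<le> w n * ennreal (f n x t)" for n
      proof (cases "n = 0")
        case False
        then have "1 \<le> (D n / c) powr (real CARD('d) / 2)"
          using c(1) c(2)[of n] by (intro ge_one_powr_ge_zero) auto
        then have "real n * 1 * f n x t \<le> real n * (D n / c) powr (real CARD('d) / 2) * f n x t"
          by (intro mult_right_mono mult_left_mono) auto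
        then show ?thesis
          by (simp add: w_def ennreal_leI flip: ennreal_mult)
      qed simp
      then have "(\<Sum>n\<le>N. ennreal (real n powr 1 * f n x t)) \<le> (\<Sum>n\<le>N. w n * ennreal (f n x t))"
        by (intro sum_mono)
      ultimately show ?thesis
        by (rule order_trans[rotated])
    qed
    show ?case
      unfolding moment_X_eq_suminf
    proof (rule suminf_le_const)
      fix N
      have "(\<Sum>n<N. ennreal (real n powr 1 * f n x t)) \<le> (\<Sum>n\<le>N. ennreal (real n powr 1 * f n x t))"
        by (rule sum_mono2) auto
      also note partial_sum_le
      finally show "(\<Sum>n<N. ennreal (real n powr 1 * f n x t))
          \<le> ennreal ((D 1 / c) powr (real CARD('d) / 2)) * ennreal C" .
    qed simp
  qed
qed

section \<open>Propagation of the second moment\<close>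

text \<open>
The production of second moment by a pair, symmetrised into products of one first and one second moment
by means of \<open>n m (n + m) = n m\<^sup>2 + n\<^sup>2 m\<close>.
\<close>

lemma collision_weight_le:
  assumes \<alpha>_le: "\<And>n m. n \<ge> 1 \<Longrightarrow> m \<ge> 1 \<Longrightarrow> \<alpha> n m \<le> C\<^sub>0 * (real n + real m)" and "0 \<le> C\<^sub>0"
  shows "ennreal (2 * real n * real m) * collision n m x t
    \<le> ennreal (2 * C\<^sub>0) * (ennreal (real n powr 1 * f n x t) * ennreal (real m powr 2 * f m x t)
        + ennreal (real n powr 2 * f n x t) * ennreal (real m powr 1 * f m x t))"
proof (cases "n = 0 \<or> m = 0")
  case False
  then have "\<alpha> n m * (2 * real n * real m * f n x t * f m x t)
      \<le> C\<^sub>0 * (real n + real m) * (2 * real n * real m * f n x t * f m x t)"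
    by (intro mult_right_mono \<alpha>_le) auto
  also have "\<dots> = (2 * C\<^sub>0) * ((real n powr 1 * f n x t) * (real m powr 2 * f m x t)
      + (real n powr 2 * f n x t) * (real m powr 1 * f m x t))"
    by (simp add: algebra_simps power2_eq_square powr_numeral)
  finally have "ennreal (\<alpha> n m * (2 * real n * real m * f n x t * f m x t)) \<le> ennreal \<dots>"
    by (rule ennreal_leI)
  then show ?thesis
    using False \<alpha>_nonneg[of n m] \<open>0 \<le> C\<^sub>0\<close>
    by (simp add: collision_def ac_simps flip: ennreal_mult ennreal_plus)
qed auto

lemma moment_Y_hat_1_le:
  assumes \<alpha>_le: "\<And>n m. n \<ge> 1 \<Longrightarrow> m \<ge> 1 \<Longrightarrow> \<alpha> n m \<le> C\<^sub>0 * (real n + real m)" and "0 \<le> C\<^sub>0"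
  shows "moment_Y_hat \<alpha> f 1 x t \<le> ennreal (4 * C\<^sub>0) * moment_X f 1 x t * moment_X f 2 x t"
proof -
  let ?a = "\<lambda>n. ennreal (real n powr 1 * f n x t)" and ?b = "\<lambda>n. ennreal (real n powr 2 * f n x t)"
  have "moment_Y_hat \<alpha> f 1 x t \<le> (\<Sum>n. \<Sum>m. ennreal (2 * C\<^sub>0) * (?a n * ?b m + ?b n * ?a m))"
    unfolding moment_Y_hat_1_eq by (intro suminf_le summableI collision_weight_le assms)
  also have "\<dots> = ennreal (2 * C\<^sub>0) * (moment_X f 1 x t * moment_X f 2 x t + moment_X f 2 x t * moment_X f 1 x t)"
    unfolding moment_X_eq_suminf ennreal_suminf_cmult suminf_add[OF summableI summableI, symmetric] ennreal_suminf_multc ..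
  also have "\<dots> = (ennreal (2 * C\<^sub>0) * 2) * moment_X f 1 x t * moment_X f 2 x t"
    by (rule ennreal_double_product)
  also have "ennreal (2 * C\<^sub>0) * 2 = ennreal (4 * C\<^sub>0)"
    using \<open>0 \<le> C\<^sub>0\<close> by (simp flip: ennreal_numeral ennreal_mult)
  finally show ?thesis .
qed

lemma truncated_moment_production_le:
  assumes \<alpha>_le: "\<And>n m. n \<ge> 1 \<Longrightarrow> m \<ge> 1 \<Longrightarrow> \<alpha> n m \<le> C\<^sub>0 * (real n + real m)" and "0 \<le> C\<^sub>0"
  shows "(\<Sum>n\<le>N. \<Sum>m\<le>N. ennreal (2 * real n * real m) * collision n m x t)
    \<le> ennreal (4 * C\<^sub>0) * moment_X f 1 x t * (\<Sum>n\<le>N. ennreal (real n powr 2 * f n x t))"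
proof -
  let ?a = "\<lambda>n. ennreal (real n powr 1 * f n x t)" and ?b = "\<lambda>n. ennreal (real n powr 2 * f n x t)"
  have "(\<Sum>n\<le>N. \<Sum>m\<le>N. ennreal (2 * real n * real m) * collision n m x t)
      \<le> (\<Sum>n\<le>N. \<Sum>m\<le>N. ennreal (2 * C\<^sub>0) * (?a n * ?b m + ?b n * ?a m))"
    by (intro sum_mono collision_weight_le assms)
  also have "\<dots> = ennreal (2 * C\<^sub>0) * ((\<Sum>n\<le>N. ?a n) * (\<Sum>n\<le>N. ?b n) + (\<Sum>n\<le>N. ?b n) * (\<Sum>n\<le>N. ?a n))"
    by (simp only: sum_product sum.distrib flip: sum_distrib_left)
  also have "\<dots> = (ennreal (2 * C\<^sub>0) * 2) * (\<Sum>n\<le>N. ?a n) * (\<Sum>n\<le>N. ?b n)"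
    by (rule ennreal_double_product)
  also have "ennreal (2 * C\<^sub>0) * 2 = ennreal (4 * C\<^sub>0)"
    using \<open>0 \<le> C\<^sub>0\<close> by (simp flip: ennreal_numeral ennreal_mult)
  also have "ennreal (4 * C\<^sub>0) * (\<Sum>n\<le>N. ?a n) * (\<Sum>n\<le>N. ?b n)
      \<le> ennreal (4 * C\<^sub>0) * moment_X f 1 x t * (\<Sum>n\<le>N. ?b n)"
    unfolding moment_X_eq_suminf by (intro mult_mono mult_left_mono sum_le_suminf) auto
  finally show ?thesis .
qed

text \<open>
The weights \<open>n\<^sup>2\<close> are subadditive up to the error \<open>2 m k\<close>.  The loss cancels, because finitely many losses
have a finite sum, and the error is estimated by the bounds on the propensities and on the first moment.
\<close>

lemma second_moment_balance:
  assumes t: "0 \<le> t"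
    and \<alpha>_le: "\<And>n m. n \<ge> 1 \<Longrightarrow> m \<ge> 1 \<Longrightarrow> \<alpha> n m \<le> C\<^sub>0 * (real n + real m)" and C\<^sub>0: "0 \<le> C\<^sub>0"
    and X1: "\<And>s. 0 < s \<Longrightarrow> AE x in lborel. moment_X f 1 x s \<le> ennreal K" and K: "0 \<le> K"
  shows "(\<Sum>n\<le>N. ennreal (real n powr 2) * (\<integral>\<^sup>+x. ennreal (f n x t) \<partial>lborel))
    \<le> (\<Sum>n\<le>N. ennreal (real n powr 2) * (\<integral>\<^sup>+x. ennreal (f n x 0) \<partial>lborel))
      + ennreal (4 * C\<^sub>0 * K) * (\<integral>\<^sup>+s\<in>{0..t}.
          (\<Sum>n\<le>N. ennreal (real n powr 2) * (\<integral>\<^sup>+x. ennreal (f n x s) \<partial>lborel)) \<partial>lborel)"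
proof -
  let ?w = "\<lambda>n. ennreal (real n powr 2)"
  define u where "u s = (\<Sum>n\<le>N. ?w n * (\<integral>\<^sup>+x. ennreal (f n x s) \<partial>lborel))" for s
  define G where "G n = (\<integral>\<^sup>+p\<in>UNIV \<times> {0..t}. gain \<alpha> f n (fst p) (snd p) \<partial>lborel)" for n
  define L where "L n = (\<integral>\<^sup>+p\<in>UNIV \<times> {0..t}. loss \<alpha> f n (fst p) (snd p) \<partial>lborel)" for n
  let ?E = "\<lambda>x s. \<Sum>m\<le>N. \<Sum>k\<le>N. ennreal (2 * real m * real k) * collision m k x s"
  have [measurable]: "UNIV \<times> {0..t} \<in> sets (borel :: ((real, 'd) vec \<times> real) measure)"
    by (intro borel_closed closed_Times) auto
  note [measurable] = measurable_uncurried_gain measurable_uncurried_loss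
  have E_meas [measurable]: "(\<lambda>p. ?E (fst p) (snd p)) \<in> borel_measurable borel"
    by (intro borel_measurable_sum borel_measurable_times_ennreal measurable_collision
        borel_measurable_const borel_measurable_continuous_onI continuous_intros)
  have "u t + (\<Sum>n\<le>N. ?w n * L n) = u 0 + (\<Sum>n\<le>N. ?w n * G n)"
  proof -
    have "?w n * (\<integral>\<^sup>+x. ennreal (f n x t) \<partial>lborel) + ?w n * L n
        = ?w n * (\<integral>\<^sup>+x. ennreal (f n x 0) \<partial>lborel) + ?w n * G n" for n
      using mass_balance[of n t] nn_integral_initial[of n] t
      by (cases "n = 0") (simp_all add: G_def L_def flip: distrib_left)
    then show ?thesis
      by (simp add: u_def flip: sum.distrib)
  qed
  also have "(\<Sum>n\<le>N. ?w n * G n) \<le> (\<Sum>n\<le>N. ?w n * L n) + (\<integral>\<^sup>+p\<in>UNIV \<times> {0..t}. ?E (fst p) (snd p) \<partial>lborel)"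
  proof -
    have "(\<Sum>n\<le>N. ?w n * gain \<alpha> f n x s) \<le> (\<Sum>n\<le>N. ?w n * loss \<alpha> f n x s) + ?E x s" for x s
    proof (rule truncated_weighted_gain_le)
      fix m k :: nat
      show "?w (m + k) \<le> ?w m + ?w k + ennreal (2 * real m * real k)"
        by (simp add: powr_numeral power2_sum flip: ennreal_plus)
    qed
    then have "(\<integral>\<^sup>+p\<in>UNIV \<times> {0..t}. (\<Sum>n\<le>N. ?w n * gain \<alpha> f n (fst p) (snd p)) \<partial>lborel)
        \<le> (\<integral>\<^sup>+p\<in>UNIV \<times> {0..t}. (\<Sum>n\<le>N. ?w n * loss \<alpha> f n (fst p) (snd p)) + ?E (fst p) (snd p) \<partial>lborel)"
      by (intro nn_integral_mono mult_right_mono) auto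
    also have "\<dots> = (\<integral>\<^sup>+p\<in>UNIV \<times> {0..t}. (\<Sum>n\<le>N. ?w n * loss \<alpha> f n (fst p) (snd p)) \<partial>lborel)
        + (\<integral>\<^sup>+p\<in>UNIV \<times> {0..t}. ?E (fst p) (snd p) \<partial>lborel)"
      by (subst nn_integral_add[symmetric]) (auto simp: distrib_right)
    finally show ?thesis
      by (simp add: G_def L_def sum_distrib_right nn_integral_sum nn_integral_cmult mult.assoc del: sum_ennreal)
  qed
  also have "(\<integral>\<^sup>+p\<in>UNIV \<times> {0..t}. ?E (fst p) (snd p) \<partial>lborel)
      = (\<integral>\<^sup>+s\<in>{0..t}. (\<integral>\<^sup>+x. ?E x s \<partial>lborel) \<partial>lborel)"
    by (rule nn_integral_strip[OF E_meas])
  also have "\<dots> \<le> (\<integral>\<^sup>+s\<in>{0..t}. ennreal (4 * C\<^sub>0 * K) * u s \<partial>lborel)"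
  proof (rule nn_integral_mono_AE)
    have "AE s in lborel. s \<noteq> (0::real)"
      by (rule AE_lborel_singleton)
    then show "AE s in lborel. (\<integral>\<^sup>+x. ?E x s \<partial>lborel) * indicator {0..t} s \<le> ennreal (4 * C\<^sub>0 * K) * u s * indicator {0..t} s"
    proof eventually_elim
      case (elim s)
      show ?case
      proof (cases "0 < s")
        case True
        have "(\<integral>\<^sup>+x. ?E x s \<partial>lborel)
            \<le> (\<integral>\<^sup>+x. ennreal (4 * C\<^sub>0 * K) * (\<Sum>n\<le>N. ennreal (real n powr 2 * f n x s)) \<partial>lborel)"
        proof (rule nn_integral_mono_AE)
          show "AE x in lborel. ?E x s \<le> ennreal (4 * C\<^sub>0 * K) * (\<Sum>n\<le>N. ennreal (real n powr 2 * f n x s))"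
            using X1[OF True]
          proof eventually_elim
            case (elim x)
            have "?E x s \<le> ennreal (4 * C\<^sub>0) * moment_X f 1 x s * (\<Sum>n\<le>N. ennreal (real n powr 2 * f n x s))"
              by (rule truncated_moment_production_le) fact+
            also have "\<dots> \<le> ennreal (4 * C\<^sub>0) * ennreal K * (\<Sum>n\<le>N. ennreal (real n powr 2 * f n x s))"
              by (intro mult_right_mono mult_left_mono elim) auto
            finally show ?case
              using C\<^sub>0 K by (simp add: ennreal_mult)
          qed
        qed
        also have "\<dots> = ennreal (4 * C\<^sub>0 * K) * u s"
          unfolding u_def by (simp add: nn_integral_cmult nn_integral_sum ennreal_mult del: sum_ennreal)
        finally show ?thesis
          by (rule mult_right_mono) simp
      qed (use elim in auto)
    qed
  qed
  also have "\<dots> = ennreal (4 * C\<^sub>0 * K) * (\<integral>\<^sup>+s\<in>{0..t}. u s \<partial>lborel)"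
    unfolding u_def by (subst nn_integral_cmult[symmetric]) (simp_all add: mult.assoc)
  finally have "u t + (\<Sum>n\<le>N. ?w n * L n)
      \<le> u 0 + ((\<Sum>n\<le>N. ?w n * L n) + ennreal (4 * C\<^sub>0 * K) * (\<integral>\<^sup>+s\<in>{0..t}. u s \<partial>lborel))"
    by (simp add: add_left_mono)
  then have "(\<Sum>n\<le>N. ?w n * L n) + u t
      \<le> (\<Sum>n\<le>N. ?w n * L n) + (u 0 + ennreal (4 * C\<^sub>0 * K) * (\<integral>\<^sup>+s\<in>{0..t}. u s \<partial>lborel))"
    by (simp only: ac_simps)
  moreover have "(\<Sum>n\<le>N. ?w n * L n) < \<infinity>"
  proof -
    have "?w n * L n < \<infinity>" for n
      using loss_integrable[of n t] t by (cases "n = 0") (simp_all add: L_def ennreal_mult_less_top)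
    then show ?thesis by simp
  qed
  ultimately have "u t \<le> u 0 + ennreal (4 * C\<^sub>0 * K) * (\<integral>\<^sup>+s\<in>{0..t}. u s \<partial>lborel)"
    by (rule ennreal_le_if_add_left_le)
  then show ?thesis
    by (simp add: u_def)
qed

text \<open>
The a priori bound that the Gronwall argument needs is the initial amount plus the total gain of the
finitely many sizes up to \<open>N\<close>; it depends on \<open>N\<close> but does not enter the conclusion.
\<close>

lemma second_moment_bound:
  assumes t: "t \<in> {0..T}"
    and \<alpha>_le: "\<And>n m. n \<ge> 1 \<Longrightarrow> m \<ge> 1 \<Longrightarrow> \<alpha> n m \<le> C\<^sub>0 * (real n + real m)" and C\<^sub>0: "0 \<le> C\<^sub>0"
    and X1: "\<And>s. 0 < s \<Longrightarrow> AE x in lborel. moment_X f 1 x s \<le> ennreal K" and K: "0 \<le> K"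
    and X2: "(\<integral>\<^sup>+x. moment_X f 2 x 0 \<partial>lborel) < \<infinity>"
  shows "(\<integral>\<^sup>+x. moment_X f 2 x t \<partial>lborel)
    \<le> 2 * (\<integral>\<^sup>+x. moment_X f 2 x 0 \<partial>lborel) * ennreal (exp (2 * (4 * C\<^sub>0 * K + 1) * t))"
proof -
  let ?w = "\<lambda>n. ennreal (real n powr 2)"
  define m where "m n s = (\<integral>\<^sup>+x. ennreal (f n x s) \<partial>lborel)" for n s
  define A where "A = (\<integral>\<^sup>+x. moment_X f 2 x 0 \<partial>lborel)"
  define G where "G n = (\<integral>\<^sup>+p\<in>UNIV \<times> {0..T}. gain \<alpha> f n (fst p) (snd p) \<partial>lborel)" for n
  have X2_eq: "(\<integral>\<^sup>+x. moment_X f 2 x s \<partial>lborel) = (\<Sum>n. ?w n * m n s)" for s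
    unfolding moment_X_eq_suminf m_def by (simp add: ennreal_mult nn_integral_suminf nn_integral_cmult)
  have A: "(\<Sum>n\<le>N. ?w n * m n 0) \<le> A" for N
    unfolding A_def X2_eq by (rule sum_le_suminf) auto
  have T: "0 \<le> T"
    using t by simp
  have m_le: "?w n * m n s \<le> ?w n * m n 0 + ?w n * G n" if "s \<in> {0..T}" for n s
  proof (cases "n = 0")
    case False
    then have n: "1 \<le> n" by simp
    have s: "0 \<le> s" using that by simp
    have "m n s \<le> m n 0 + (\<integral>\<^sup>+p\<in>UNIV \<times> {0..s}. gain \<alpha> f n (fst p) (snd p) \<partial>lborel)"
      unfolding m_def nn_integral_initial[OF n] mass_balance[OF n s, symmetric] by simp
    also have "(\<integral>\<^sup>+p\<in>UNIV \<times> {0..s}. gain \<alpha> f n (fst p) (snd p) \<partial>lborel) \<le> G n"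
      unfolding G_def using that by (intro nn_integral_mono) (auto simp: indicator_def)
    finally show ?thesis
      by (simp add: mult_left_mono add_left_mono flip: distrib_left)
  qed simp
  have bound: "(\<Sum>n\<le>N. ?w n * m n t) \<le> 2 * A * ennreal (exp (2 * (4 * C\<^sub>0 * K + 1) * t))" for N
  proof (rule gronwall_crude[where T = T])
    \<comment> \<open>The summand \<open>1\<close> keeps the rate positive when there are no collisions at all.\<close>
    show "0 < 4 * C\<^sub>0 * K + 1"
      using C\<^sub>0 K by (simp add: add_nonneg_pos)
    show "(\<Sum>n\<le>N. ?w n * m n s) \<le> (\<Sum>n\<le>N. ?w n * m n 0 + ?w n * G n)" if "s \<in> {0..T}" for s
      by (intro sum_mono m_le that)
    have "?w n * G n < \<infinity>" for n
      using gain_integrable[OF _ T, of n] by (cases "n = 0") (simp_all add: G_def ennreal_mult_less_top)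
    moreover have "(\<Sum>n\<le>N. ?w n * m n 0) < \<infinity>"
      using A X2 unfolding A_def by (rule le_less_trans)
    ultimately show "(\<Sum>n\<le>N. ?w n * m n 0 + ?w n * G n) < \<infinity>"
      by (simp add: sum.distrib)
  next
    fix s assume s: "s \<in> {0..T}"
    then have "0 \<le> s" by simp
    have "(\<Sum>n\<le>N. ?w n * m n s) \<le> (\<Sum>n\<le>N. ?w n * m n 0)
        + ennreal (4 * C\<^sub>0 * K) * (\<integral>\<^sup>+r\<in>{0..s}. (\<Sum>n\<le>N. ?w n * m n r) \<partial>lborel)"
      unfolding m_def by (rule second_moment_balance[OF \<open>0 \<le> s\<close> \<alpha>_le C\<^sub>0 X1 K])
    also have "\<dots> \<le> A + ennreal (4 * C\<^sub>0 * K + 1) * (\<integral>\<^sup>+r\<in>{0..s}. (\<Sum>n\<le>N. ?w n * m n r) \<partial>lborel)"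
      by (intro add_mono A mult_right_mono ennreal_leI) auto
    finally show "(\<Sum>n\<le>N. ?w n * m n s)
        \<le> A + ennreal (4 * C\<^sub>0 * K + 1) * (\<integral>\<^sup>+r\<in>{0..s}. (\<Sum>n\<le>N. ?w n * m n r) \<partial>lborel)" .
  qed (use t in auto)
  have "(\<Sum>n. ?w n * m n t) \<le> 2 * A * ennreal (exp (2 * (4 * C\<^sub>0 * K + 1) * t))"
  proof (rule suminf_le_const)
    fix N
    have "(\<Sum>n<N. ?w n * m n t) \<le> (\<Sum>n\<le>N. ?w n * m n t)"
      by (rule sum_mono2) auto
    also note bound
    finally show "(\<Sum>n<N. ?w n * m n t) \<le> 2 * A * ennreal (exp (2 * (4 * C\<^sub>0 * K + 1) * t))" .
  qed simp
  then show ?thesis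
    by (simp only: X2_eq A_def)
qed

lemma moment_Y_hat_1_integrable:
  assumes \<alpha>_le: "\<And>n m. n \<ge> 1 \<Longrightarrow> m \<ge> 1 \<Longrightarrow> \<alpha> n m \<le> C\<^sub>0 * (real n + real m)"
    and X1: "\<And>s. 0 < s \<Longrightarrow> AE x in lborel. moment_X f 1 x s \<le> ennreal K"
    and X2: "(\<integral>\<^sup>+x. moment_X f 2 x 0 \<partial>lborel) < \<infinity>"
  shows "(\<integral>\<^sup>+t\<in>{0..T}. (\<integral>\<^sup>+x. moment_Y_hat \<alpha> f 1 x t \<partial>lborel) \<partial>lborel) < \<infinity>"
proof -
  define K' where "K' = max 0 K"
  have K': "0 \<le> K'" and X1': "AE x in lborel. moment_X f 1 x s \<le> ennreal K'" if "0 < s" for s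
    using X1[OF that] by (auto simp: K'_def max_def ennreal_neg)
  have C\<^sub>0: "0 \<le> C\<^sub>0"
    using \<alpha>_le[of 1 1] \<alpha>_nonneg[of 1 1] by simp
  define B where "B = 4 * C\<^sub>0 * K'"
  define A where "A = (\<integral>\<^sup>+x. moment_X f 2 x 0 \<partial>lborel)"
  define M where "M = ennreal B * (2 * A * ennreal (exp (2 * (B + 1) * T)))"
  have B: "0 \<le> B"
    using C\<^sub>0 by (simp add: B_def K'_def)
  have "(\<integral>\<^sup>+t\<in>{0..T}. (\<integral>\<^sup>+x. moment_Y_hat \<alpha> f 1 x t \<partial>lborel) \<partial>lborel) \<le> (\<integral>\<^sup>+t\<in>{0..T}. M \<partial>lborel)"
  proof (rule nn_integral_mono_AE)
    have "AE s in lborel. s \<noteq> (0::real)"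
      by (rule AE_lborel_singleton)
    then show "AE s in lborel. (\<integral>\<^sup>+x. moment_Y_hat \<alpha> f 1 x s \<partial>lborel) * indicator {0..T} s \<le> M * indicator {0..T} s"
    proof eventually_elim
      case (elim s)
      show ?case
      proof (cases "s \<in> {0..T}")
        case True
        with elim have s: "0 < s" by auto
        have "(\<integral>\<^sup>+x. moment_Y_hat \<alpha> f 1 x s \<partial>lborel) \<le> (\<integral>\<^sup>+x. ennreal B * moment_X f 2 x s \<partial>lborel)"
        proof (rule nn_integral_mono_AE)
          show "AE x in lborel. moment_Y_hat \<alpha> f 1 x s \<le> ennreal B * moment_X f 2 x s"
            using X1'[OF s]
          proof eventually_elim
            case (elim x)
            have "moment_Y_hat \<alpha> f 1 x s \<le> ennreal (4 * C\<^sub>0) * moment_X f 1 x s * moment_X f 2 x s"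
              by (rule moment_Y_hat_1_le) fact+
            also have "\<dots> \<le> ennreal (4 * C\<^sub>0) * ennreal K' * moment_X f 2 x s"
              by (intro mult_right_mono mult_left_mono elim) auto
            finally show ?case
              using C\<^sub>0 by (simp add: ennreal_mult B_def K'_def)
          qed
        qed
        also have "\<dots> = ennreal B * (\<integral>\<^sup>+x. moment_X f 2 x s \<partial>lborel)"
          by (rule nn_integral_cmult) measurable
        also have "(\<integral>\<^sup>+x. moment_X f 2 x s \<partial>lborel) \<le> 2 * A * ennreal (exp (2 * (B + 1) * s))"
          unfolding A_def B_def by (rule second_moment_bound[OF True \<alpha>_le C\<^sub>0 X1' K' X2]) (use s in auto)
        also have "exp (2 * (B + 1) * s) \<le> exp (2 * (B + 1) * T)"
          using True B by (simp add: mult_left_mono)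
        finally have "(\<integral>\<^sup>+x. moment_Y_hat \<alpha> f 1 x s \<partial>lborel) \<le> M"
          unfolding M_def by (simp add: mult_left_mono ennreal_leI)
        then show ?thesis
          by (rule mult_right_mono) simp
      qed simp
    qed
  qed
  also have "\<dots> = M * emeasure lborel {0..T}"
    by (simp add: nn_integral_cmult_indicator)
  also have "\<dots> < \<infinity>"
    using X2 by (cases "0 \<le> T") (auto simp: M_def A_def ennreal_mult_less_top)
  finally show ?thesis .
qed

theorem mass_conserved_if_initially_bounded:
  assumes X1: "AE x in lborel. moment_X f 1 x 0 \<le> ennreal C"
    and X2: "(\<integral>\<^sup>+x. moment_X f 2 x 0 \<partial>lborel) < \<infinity>"
    and c: "0 < c" "\<And>n. 1 \<le> n \<Longrightarrow> c \<le> D n"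
    and decr: "\<And>n m. 1 \<le> n \<Longrightarrow> n \<le> m \<Longrightarrow> D m \<le> D n"
    and \<alpha>_le: "\<And>n m. n \<ge> 1 \<Longrightarrow> m \<ge> 1 \<Longrightarrow> \<alpha> n m \<le> C\<^sub>0 * (real n + real m)"
  shows "conserves_mass_on f {0..}"
  unfolding conserves_mass_on_def
proof
  fix t :: real assume "t \<in> {0..}"
  have X1_later: "AE x in lborel. moment_X f 1 x s \<le> ennreal ((D 1 / c) powr (real CARD('d) / 2) * C)" if "0 < s" for s
    using first_moment_bound[OF c decr that X1] by (simp add: ennreal_mult')
  have "conserves_mass_on f {0..t}"
    by (rule mass_conserved_if_moment_Y_hat_integrable[OF moment_Y_hat_1_integrable[OF \<alpha>_le X1_later X2]])
  moreover have "t \<in> {0..t}"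
    using \<open>t \<in> {0..}\<close> by simp
  ultimately show "mass f t = mass f 0"
    unfolding conserves_mass_on_def by blast
qed

end

section \<open>Removing the normalisation\<close>

definition extend_by_zero ::
    "(nat \<Rightarrow> (real, 'd::finite) vec \<Rightarrow> real \<Rightarrow> real) \<Rightarrow> nat \<Rightarrow> (real, 'd) vec \<Rightarrow> real \<Rightarrow> real" where
  "extend_by_zero f n x t = (if 1 \<le> n \<and> 0 \<le> t then f n x t else 0)"

lemma extend_by_zero_cong:
  assumes "0 \<le> t"
  shows "1 \<le> n \<Longrightarrow> gain \<alpha> (extend_by_zero f) n x t = gain \<alpha> f n x t"
    and "1 \<le> n \<Longrightarrow> loss \<alpha> (extend_by_zero f) n x t = loss \<alpha> f n x t"
    and "1 \<le> n \<Longrightarrow> coag \<alpha> (extend_by_zero f) n x t = coag \<alpha> f n x t"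
    and "moment_X (extend_by_zero f) a x t = moment_X f a x t"
    and "moment_Y_hat \<alpha> (extend_by_zero f) a x t = moment_Y_hat \<alpha> f a x t"
    and "mass (extend_by_zero f) t = mass f t"
proof -
  show *: "gain \<alpha> (extend_by_zero f) n x t = gain \<alpha> f n x t" if "1 \<le> n" for n
    unfolding gain_def using assms by (intro arg_cong[where f = ennreal] sum.cong) (auto simp: extend_by_zero_def)
  show **: "loss \<alpha> (extend_by_zero f) n x t = loss \<alpha> f n x t" if "1 \<le> n" for n
    unfolding loss_def using assms that
    by (intro arg_cong2[where f = "(*)"] infsum_cong) (auto simp: extend_by_zero_def)
  show "coag \<alpha> (extend_by_zero f) n x t = coag \<alpha> f n x t" if "1 \<le> n" for n
    using that by (simp add: coag_def * **)
  show "moment_X (extend_by_zero f) a x t = moment_X f a x t"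
    unfolding moment_X_def using assms by (intro infsum_cong) (auto simp: extend_by_zero_def)
  show "moment_Y_hat \<alpha> (extend_by_zero f) a x t = moment_Y_hat \<alpha> f a x t"
    unfolding moment_Y_hat_def using assms by (intro infsum_cong) (auto simp: extend_by_zero_def)
  show "mass (extend_by_zero f) t = mass f t"
    unfolding mass_def using assms by (intro infsum_cong) (auto simp: extend_by_zero_def)
qed

text \<open>
The definition of a weak solution looks at sizes \<open>n \<ge> 1\<close> and times \<open>t \<ge> 0\<close> only, where nothing changes.
\<close>

lemma global_weak_solution_extend_by_zero:
  fixes f :: "nat \<Rightarrow> (real, 'd::finite) vec \<Rightarrow> real \<Rightarrow> real"
  assumes D_nonneg: "\<And>n. n \<ge> 1 \<Longrightarrow> D n \<ge> 0"
    and \<alpha>_nonneg: "\<And>n m. n \<ge> 1 \<Longrightarrow> m \<ge> 1 \<Longrightarrow> \<alpha> n m \<ge> 0"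
    and \<alpha>_sym: "\<And>n m. n \<ge> 1 \<Longrightarrow> m \<ge> 1 \<Longrightarrow> \<alpha> n m = \<alpha> m n"
    and weak: "weak_solution D \<alpha> f0 f"
  shows "global_weak_solution D \<alpha> f0 (extend_by_zero f)"
proof
  let ?g = "extend_by_zero f"
  have f_nonneg: "0 \<le> f n x t" if "1 \<le> n" "0 \<le> t" for n x t
    using weak that by (auto simp: weak_solution_def)
  show g_nonneg: "0 \<le> ?g n x t" for n x t
    using f_nonneg by (simp add: extend_by_zero_def)
  show "?g 0 x t = 0" for x t
    by (simp add: extend_by_zero_def)
  show g_meas: "(\<lambda>(x, t). ?g n x t) \<in> borel_measurable borel" for n
  proof (cases "n = 0")
    case False
    have "(\<lambda>(x, t). ?g n x t) = (\<lambda>p. indicator (UNIV \<times> {0..}) p *\<^sub>R (case p of (x, t) \<Rightarrow> f n x t))"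
      using False by (auto simp: extend_by_zero_def indicator_def fun_eq_iff)
    moreover have "\<dots> \<in> borel_measurable borel"
      using weak False by (simp add: weak_solution_def set_borel_measurable_def Suc_le_eq)
    ultimately show ?thesis by simp
  qed (simp add: extend_by_zero_def case_prod_beta')
  have int_cong: "(\<integral>\<^sup>+p\<in>UNIV \<times> {0..T}. h (fst p) (snd p) \<partial>lborel) = (\<integral>\<^sup>+p\<in>UNIV \<times> {0..T}. h' (fst p) (snd p) \<partial>lborel)"
    if "\<And>x t. 0 \<le> t \<Longrightarrow> h x t = h' x t" for T and h h' :: "(real, 'd) vec \<Rightarrow> real \<Rightarrow> ennreal"
    using that by (intro nn_integral_cong) (auto simp: indicator_def)
  have flow_cong: "(LINT s:{0..t}|lborel. heat_semigroup (D n) (t - s) (\<lambda>y. coag \<alpha> ?g n y s) x)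
      = (LINT s:{0..t}|lborel. heat_semigroup (D n) (t - s) (\<lambda>y. coag \<alpha> f n y s) x)" if "1 \<le> n" for n x t
    using that by (intro set_lebesgue_integral_cong) (auto simp: extend_by_zero_cong)
  show "weak_solution D \<alpha> f0 ?g"
    unfolding weak_solution_def
  proof (intro conjI allI impI)
    fix n :: nat and T :: real assume "1 \<le> n" "0 \<le> T"
    show "(\<integral>\<^sup>+p\<in>UNIV \<times> {0..T}. gain \<alpha> ?g n (fst p) (snd p) \<partial>lborel) < \<infinity>"
      using weak \<open>1 \<le> n\<close> \<open>0 \<le> T\<close>
      by (subst int_cong[of _ "gain \<alpha> f n"]) (auto simp: extend_by_zero_cong weak_solution_def)
    show "(\<integral>\<^sup>+p\<in>UNIV \<times> {0..T}. loss \<alpha> ?g n (fst p) (snd p) \<partial>lborel) < \<infinity>"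
      using weak \<open>1 \<le> n\<close> \<open>0 \<le> T\<close>
      by (subst int_cong[of _ "loss \<alpha> f n"]) (auto simp: extend_by_zero_cong weak_solution_def)
  next
    fix n :: nat and t :: real assume n: "1 \<le> n" and t: "0 \<le> t"
    have "?g n x t = f n x t" for x
      using n t by (simp add: extend_by_zero_def)
    then show "AE x in lborel.
        (D n * t > 0 \<longrightarrow> integrable lborel (\<lambda>y. heat_kernel (D n * t) (x - y) * f0 n y)) \<and>
        ?g n x t = heat_semigroup (D n) t (f0 n) x
          + (LINT s:{0..t}|lborel. heat_semigroup (D n) (t - s) (\<lambda>y. coag \<alpha> ?g n y s) x)"
      using weak n t by (simp add: flow_cong weak_solution_def)
  next
    fix n :: nat
    have "(\<lambda>p. indicator (UNIV \<times> {0..}) p *\<^sub>R (case p of (x, t) \<Rightarrow> ?g n x t)) = (\<lambda>(x, t). ?g n x t)"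
      by (auto simp: extend_by_zero_def indicator_def fun_eq_iff)
    then show "set_borel_measurable borel (UNIV \<times> {0..}) (\<lambda>(x, t). ?g n x t)"
      unfolding set_borel_measurable_def using g_meas[of n] by simp
  qed (use weak g_nonneg in \<open>auto simp: weak_solution_def\<close>)
qed (fact D_nonneg \<alpha>_nonneg \<alpha>_sym)+

theorem theorem1p3:
  fixes D :: "nat \<Rightarrow> real"
    and \<alpha> :: "nat \<Rightarrow> nat \<Rightarrow> real"
    and f0 :: "nat \<Rightarrow> (real, 'd::finite) vec \<Rightarrow> real"
    and f :: "nat \<Rightarrow> (real, 'd) vec \<Rightarrow> real \<Rightarrow> real"
  assumes D_nonneg: "\<And>n. n \<ge> 1 \<Longrightarrow> D n \<ge> 0"
    and \<alpha>_nonneg: "\<And>n m. n \<ge> 1 \<Longrightarrow> m \<ge> 1 \<Longrightarrow> \<alpha> n m \<ge> 0"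
    and \<alpha>_sym: "\<And>n m. n \<ge> 1 \<Longrightarrow> m \<ge> 1 \<Longrightarrow> \<alpha> n m = \<alpha> m n"
    and weak: "weak_solution D \<alpha> f0 f"
  shows
    "(\<forall>T>0. (\<integral>\<^sup>+ t \<in> {0..T}. (\<integral>\<^sup>+ x. moment_Y D f 1 x t \<partial>lborel) \<partial>lborel) < \<infinity> \<longrightarrow>
            (\<integral>\<^sup>+ t \<in> {0..T}. (\<integral>\<^sup>+ x. moment_Y_hat \<alpha> f 1 x t \<partial>lborel) \<partial>lborel) < \<infinity> \<longrightarrow>
            conserves_mass_on f {0..T})
     \<and>
     ((\<exists>C::real. AE x in lborel. moment_X f 1 x 0 \<le> ennreal C) \<longrightarrow>
      (\<integral>\<^sup>+ x. moment_X f 2 x 0 \<partial>lborel) < \<infinity> \<longrightarrow>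
      (\<exists>c>0. \<forall>n\<ge>1. c \<le> D n) \<longrightarrow>
      (\<forall>n\<ge>1. \<forall>m\<ge>n. D m \<le> D n) \<longrightarrow>
      (\<exists>C\<^sub>0::real. \<forall>n\<ge>1. \<forall>m\<ge>1. \<alpha> n m \<le> C\<^sub>0 * (real n + real m)) \<longrightarrow>
      conserves_mass_on f {0..})"
proof -
  interpret g: global_weak_solution D \<alpha> f0 "extend_by_zero f"
    by (intro global_weak_solution_extend_by_zero assms)
  have conserves: "conserves_mass_on f J" if "conserves_mass_on (extend_by_zero f) J" "J \<subseteq> {0..}" for J
    using that by (auto simp: conserves_mass_on_def extend_by_zero_cong(6) subset_eq)
  show ?thesis
  proof (intro conjI allI impI)
    fix T :: real
    assume "(\<integral>\<^sup>+t\<in>{0..T}. (\<integral>\<^sup>+x. moment_Y_hat \<alpha> f 1 x t \<partial>lborel) \<partial>lborel) < \<infinity>"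
    moreover have "(\<integral>\<^sup>+t\<in>{0..T}. (\<integral>\<^sup>+x. moment_Y_hat \<alpha> (extend_by_zero f) 1 x t \<partial>lborel) \<partial>lborel)
        = (\<integral>\<^sup>+t\<in>{0..T}. (\<integral>\<^sup>+x. moment_Y_hat \<alpha> f 1 x t \<partial>lborel) \<partial>lborel)"
      by (intro nn_integral_cong) (auto simp: indicator_def extend_by_zero_cong(5))
    ultimately show "conserves_mass_on f {0..T}"
      by (intro conserves g.mass_conserved_if_moment_Y_hat_integrable) auto
  next
    assume "\<exists>C::real. AE x in lborel. moment_X f 1 x 0 \<le> ennreal C"
      and X2: "(\<integral>\<^sup>+x. moment_X f 2 x 0 \<partial>lborel) < \<infinity>"
      and "\<exists>c>0. \<forall>n\<ge>1. c \<le> D n" and decr: "\<forall>n\<ge>1. \<forall>m\<ge>n. D m \<le> D n"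
      and "\<exists>C\<^sub>0::real. \<forall>n\<ge>1. \<forall>m\<ge>1. \<alpha> n m \<le> C\<^sub>0 * (real n + real m)"
    then obtain C c C\<^sub>0 where X1: "AE x in lborel. moment_X f 1 x 0 \<le> ennreal C"
      and c: "0 < c" "\<forall>n\<ge>1. c \<le> D n"
      and \<alpha>_le: "\<forall>n\<ge>1. \<forall>m\<ge>1. \<alpha> n m \<le> C\<^sub>0 * (real n + real m)"
      by blast
    show "conserves_mass_on f {0..}"
    proof (rule conserves)
      show "conserves_mass_on (extend_by_zero f) {0..}"
        using X1 X2 c decr \<alpha>_le
        by (intro g.mass_conserved_if_initially_bounded[of C c C\<^sub>0]) (auto simp: extend_by_zero_cong(4))
    qed simp
  qed
qed

end
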